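(* Suppose that $F$ is a function such that whenever $\mathcal{G}_e$ is a computable abelian group $E$, and $C_a$, $C_b$, $C_g$, $C_h$ are computable subsets of $E$ which, with the group operation inherited from $E$, are subgroups $A, B, G, H$ satisfying $E = A \oplus G = B \oplus H$, and $A$ and $B$ are isomorphic and finitely generated of rank $r$, with $a_1,\dots,a_n$ generators of $A$ and $b_1,\dots,b_n$ generators of $B$, we have that $\varphi_{F(e,a,b,g,h,r,a_1,\dots,a_n,b_1,\dots,b_n)}$ is an isomorphism from $G$ to $H$. Then $\emptyset'\le_T F$.
   Context: All groups are abelian. $\varphi_n$ denotes the $n$-th partial computable function in a standard enumeration; $\mathcal{G}_e$ denotes the computable group with index $e$ (domain a subset of $\omega$, atomic diagram computed by the $e$-th program); $C_a$ denotes the computable set whose characteristic function is $\varphi_a$. $E = A\oplus G$ means $E$ is the internal direct sum of its subgroups $A$ and $G$. The rank of an abelian group is the cardinality of a maximal linearly independent subset. $\emptyset'$ is the halting set and $\le_T$ is Turing reducibility. *)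

theory Defs
  imports "HOL-Library.Nat_Bijection" "HOL-Algebra.Algebra"
begin

datatype rf = RZero | RSucc | RFst | RSnd | RPair rf rf | RComp rf rf | RRec rf rf | RMu rf | ROrc

inductive eval :: "(nat \<Rightarrow> nat) \<Rightarrow> rf \<Rightarrow> nat \<Rightarrow> nat \<Rightarrow> bool" for orc where
  eZero: "eval orc RZero x 0"
| eSucc: "eval orc RSucc x (Suc x)"
| eFst:  "eval orc RFst x (fst (prod_decode x))"
| eSnd:  "eval orc RSnd x (snd (prod_decode x))"
| ePair: "eval orc f x y \<Longrightarrow> eval orc g x z \<Longrightarrow> eval orc (RPair f g) x (prod_encode (y, z))"
| eComp: "eval orc g x y \<Longrightarrow> eval orc f y z \<Longrightarrow> eval orc (RComp f g) x z"
| eRec0: "eval orc f y z \<Longrightarrow> eval orc (RRec f g) (prod_encode (y, 0)) z"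
| eRecS: "eval orc (RRec f g) (prod_encode (y, n)) z \<Longrightarrow>
           eval orc g (prod_encode (y, prod_encode (n, z))) w \<Longrightarrow>
           eval orc (RRec f g) (prod_encode (y, Suc n)) w"
| eMu:   "eval orc f (prod_encode (x, n)) 0 \<Longrightarrow>
           (\<forall>m<n. \<exists>k. k \<noteq> 0 \<and> eval orc f (prod_encode (x, m)) k) \<Longrightarrow>
           eval orc (RMu f) x n"
| eOrc:  "eval orc ROrc x (orc x)"

primrec enc :: "rf \<Rightarrow> nat" where
  "enc RZero = prod_encode (0, 0)"
| "enc RSucc = prod_encode (1, 0)"
| "enc RFst = prod_encode (2, 0)"
| "enc RSnd = prod_encode (3, 0)"
| "enc (RPair f g) = prod_encode (4, prod_encode (enc f, enc g))"
| "enc (RComp f g) = prod_encode (5, prod_encode (enc f, enc g))"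
| "enc (RRec f g) = prod_encode (6, prod_encode (enc f, enc g))"
| "enc (RMu f) = prod_encode (7, enc f)"
| "enc ROrc = prod_encode (8, 0)"

text \<open>Program with index n; non-codes denote the nowhere-defined program.\<close>
definition prog :: "nat \<Rightarrow> rf" where
  "prog n = (if \<exists>p. enc p = n then (THE p. enc p = n) else RMu RSucc)"

text \<open>Oracle-free computations (the oracle is irrelevant; we use the zero oracle).\<close>
abbreviation ceval :: "rf \<Rightarrow> nat \<Rightarrow> nat \<Rightarrow> bool" where
  "ceval p x y \<equiv> eval (\<lambda>_. 0) p x y"

definition phi :: "nat \<Rightarrow> nat \<Rightarrow> nat option" where
  "phi n x = (if \<exists>y. ceval (prog n) x y then Some (THE y. ceval (prog n) x y) else None)"

definition is_char_index :: "nat \<Rightarrow> bool" where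
  "is_char_index a \<longleftrightarrow> (\<forall>x. phi a x = Some 0 \<or> phi a x = Some 1)"

definition Cset :: "nat \<Rightarrow> nat set" where
  "Cset a = {x. phi a x = Some 1}"

definition halting_set :: "nat set" where
  "halting_set = {e. phi e e \<noteq> None}"

definition halting_le_T :: "(nat list \<Rightarrow> nat) \<Rightarrow> bool" where
  "halting_le_T F \<longleftrightarrow>
     (\<exists>p. \<forall>x. eval (\<lambda>c. F (list_decode c)) p x (if x \<in> halting_set then 1 else 0))"

definition gdom :: "nat \<Rightarrow> nat set" where
  "gdom e = {x. phi e (prod_encode (0, x)) = Some 1}"

definition gop :: "nat \<Rightarrow> nat \<Rightarrow> nat \<Rightarrow> nat" where
  "gop e x y = the (phi e (prod_encode (1, prod_encode (x, y))))"

definition grp :: "nat \<Rightarrow> nat monoid" where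
  "grp e = \<lparr>carrier = gdom e, monoid.mult = gop e,
            monoid.one = (THE u. u \<in> gdom e \<and> (\<forall>x\<in>gdom e. gop e u x = x \<and> gop e x u = x))\<rparr>"

definition computable_group :: "nat \<Rightarrow> bool" where
  "computable_group e \<longleftrightarrow>
     (\<forall>x. phi e (prod_encode (0, x)) = Some 0 \<or> phi e (prod_encode (0, x)) = Some 1) \<and>
     (\<forall>x\<in>gdom e. \<forall>y\<in>gdom e. phi e (prod_encode (1, prod_encode (x, y))) \<noteq> None) \<and>
     comm_group (grp e)"

definition internal_dsum :: "('a, 'b) monoid_scheme \<Rightarrow> 'a set \<Rightarrow> 'a set \<Rightarrow> bool" where
  "internal_dsum E A G \<longleftrightarrow> subgroup A E \<and> subgroup G E \<and> A \<inter> G = {\<one>\<^bsub>E\<^esub>} \<and>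
     A <#>\<^bsub>E\<^esub> G = carrier E"

definition lin_indep :: "('a, 'b) monoid_scheme \<Rightarrow> 'a set \<Rightarrow> bool" where
  "lin_indep E S \<longleftrightarrow> S \<subseteq> carrier E \<and>
     (\<forall>T c. T \<subseteq> S \<longrightarrow> finite T \<longrightarrow>
        finprod E (\<lambda>t. t [^]\<^bsub>E\<^esub> (c t :: int)) T = \<one>\<^bsub>E\<^esub> \<longrightarrow> (\<forall>t\<in>T. c t = 0))"

definition has_rank :: "('a, 'b) monoid_scheme \<Rightarrow> nat \<Rightarrow> bool" where
  "has_rank E r \<longleftrightarrow> (\<exists>S. lin_indep E S \<and> (\<forall>S'. lin_indep E S' \<and> S \<subseteq> S' \<longrightarrow> S' = S)
                          \<and> finite S \<and> card S = r)"

definition phi_iso :: "nat \<Rightarrow> nat monoid \<Rightarrow> nat monoid \<Rightarrow> bool" where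
  "phi_iso k G H \<longleftrightarrow> (\<forall>x\<in>carrier G. phi k x \<noteq> None) \<and> (\<lambda>x. the (phi k x)) \<in> iso G H"

end

theory Submission
  imports Defs "HOL-Library.Product_Plus" "HOL-Number_Theory.Cong"
begin

text \<open>Inside \<open>U = \<int> \<times> \<int> \<times> \<int>[1/2]\<close> let \<open>A\<close> and \<open>B\<close> be generated by \<open>a = (1, 0, 0)\<close> and
  \<open>b = (6, - 17, 1)\<close>, with complements \<open>{x = 0}\<close> and \<open>{v = - 3 x}\<close>. For a program \<open>x\<close> build a
  computable group that equals \<open>\<langle>a, b\<rangle>\<close> if \<open>x\<close> never halts on itself, and that grows to all of \<open>U\<close>
  once it does. In the first case the complements are infinite cyclic, generated by
  \<open>b - 6 a\<close> and \<open>a - 3 b\<close>, so every isomorphism sends \<open>b - 6 a\<close> to \<open>\<plusminus> (a - 3 b)\<close>. In the second case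
  an isomorphism preserves the infinitely 2-divisible elements and hence multiplies the last
  coordinate axis by a unit \<open>\<plusminus> 2\<^sup>i\<close> of \<open>\<int>[1/2]\<close>; reducing modulo 17, where 3 is not of the form
  \<open>\<plusminus> 2\<^sup>i\<close>, shows that \<open>b - 6 a\<close> is never sent to \<open>\<plusminus> (a - 3 b)\<close>. Evaluating the isomorphism given by
  \<open>F\<close> at \<open>b - 6 a\<close> therefore decides the halting problem.\<close>

section \<open>Computable functions\<close>

abbreviation p1 :: "nat \<Rightarrow> nat" where "p1 x \<equiv> fst (prod_decode x)"
abbreviation p2 :: "nat \<Rightarrow> nat" where "p2 x \<equiv> snd (prod_decode x)"
abbreviation pr :: "nat \<Rightarrow> nat \<Rightarrow> nat" where "pr x y \<equiv> prod_encode (x, y)"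

section \<open>Determinism of evaluation and injectivity of program codes\<close>

inductive_cases eval_RZero: "eval orc RZero x y"
inductive_cases eval_RSucc: "eval orc RSucc x y"
inductive_cases eval_RFst: "eval orc RFst x y"
inductive_cases eval_RSnd: "eval orc RSnd x y"
inductive_cases eval_ROrc: "eval orc ROrc x y"
inductive_cases eval_RPair: "eval orc (RPair f g) x y"
inductive_cases eval_RComp: "eval orc (RComp f g) x y"
inductive_cases eval_RMu: "eval orc (RMu f) x y"
inductive_cases eval_RRec: "eval orc (RRec f g) x y"

text \<open>Induction on the first derivation. Minimisation is the delicate case: two different
  results would make the body both zero and nonzero at the smaller of them.\<close>

lemma eval_det: "eval orc p x y \<Longrightarrow> eval orc p x z \<Longrightarrow> y = z"
proof (induction arbitrary: z rule: eval.induct)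
  case (ePair f x y g z')
  from ePair.prems show ?case by (rule eval_RPair) (metis ePair.IH)
next
  case (eComp g x y f z')
  from eComp.prems show ?case by (rule eval_RComp) (metis eComp.IH)
next
  case (eRec0 f y z' g)
  from eRec0.prems show ?case
  proof (rule eval_RRec)
    fix y' assume "prod_encode (y, 0) = prod_encode (y', 0)" "eval orc f y' z"
    then show ?thesis using eRec0.IH by (simp add: prod_encode_eq)
  qed (simp add: prod_encode_eq)
next
  case (eRecS f g y n z' w)
  from eRecS.prems show ?case
  proof (rule eval_RRec)
    fix y' n' u assume "prod_encode (y, Suc n) = prod_encode (y', Suc n')"
      and u: "eval orc (RRec f g) (prod_encode (y', n')) u"
      and w: "eval orc g (prod_encode (y', prod_encode (n', u))) z"
    then have "y' = y" "n' = n" by (simp_all add: prod_encode_eq)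
    with u w eRecS.IH show ?thesis by metis
  qed (simp add: prod_encode_eq)
next
  case (eMu f x n)
  from eMu.prems have z: "eval orc f (prod_encode (x, z)) 0"
    "\<forall>m<z. \<exists>k. k \<noteq> 0 \<and> eval orc f (prod_encode (x, m)) k"
    by (auto elim: eval_RMu)
  show ?case
  proof (rule linorder_cases[of n z])
    assume "n < z" with z eMu.IH(1) show ?thesis by blast
  next
    assume "z < n" with z eMu.IH(2) show ?thesis by blast
  qed
qed (auto elim: eval_RZero eval_RSucc eval_RFst eval_RSnd eval_ROrc)

lemma enc_inj: "enc p = enc q \<Longrightarrow> p = q"
proof (induction p arbitrary: q)
  case RZero then show ?case by (cases q) (auto simp: prod_encode_eq)
next case RSucc then show ?case by (cases q) (auto simp: prod_encode_eq)
next case RFst then show ?case by (cases q) (auto simp: prod_encode_eq)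
next case RSnd then show ?case by (cases q) (auto simp: prod_encode_eq)
next case (RPair f g) then show ?case by (cases q) (auto simp: prod_encode_eq)
next case (RComp f g) then show ?case by (cases q) (auto simp: prod_encode_eq)
next case (RRec f g) then show ?case by (cases q) (auto simp: prod_encode_eq)
next case (RMu f) then show ?case by (cases q) (auto simp: prod_encode_eq)
next case ROrc then show ?case by (cases q) (auto simp: prod_encode_eq)
qed

lemma prog_enc [simp]: "prog (enc p) = p"
proof -
  have "(THE q. enc q = enc p) = p" by (rule the_equality) (auto intro: enc_inj)
  then show ?thesis unfolding prog_def by auto
qed

lemma phi_eq_Some_iff: "phi n x = Some y \<longleftrightarrow> ceval (prog n) x y"
proof -
  have the: "(THE y. ceval (prog n) x y) = z" if "ceval (prog n) x z" for z
    using that by (rule the_equality) (rule eval_det[OF _ that])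
  show ?thesis unfolding phi_def using the by auto
qed

lemma phi_enc: "ceval p x y \<Longrightarrow> phi (enc p) x = Some y"
  by (simp add: phi_eq_Some_iff)

text \<open>The default program \<open>RMu RSucc\<close> diverges everywhere because a successor is
  never zero.\<close>

lemma phi_noncode: "\<nexists>p. enc p = n \<Longrightarrow> phi n x = None"
proof -
  assume "\<nexists>p. enc p = n"
  then have p: "prog n = RMu RSucc" by (simp add: prog_def)
  have "\<not> ceval (RMu RSucc) x y" for y
  proof
    assume "ceval (RMu RSucc) x y"
    then have "ceval RSucc (prod_encode (x, y)) 0" by (rule eval_RMu)
    then show False by (rule eval_RSucc) simp
  qed
  with p show ?thesis by (simp add: phi_def)
qed

text \<open>One program must serve all oracles in \<open>Os\<close>. For \<open>Os = UNIV\<close>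
  this is oracle-free computability, for \<open>Os = {orc}\<close> computability relative to
  \<open>orc\<close>, so one set of closure rules covers both the group construction and the final
  reduction.\<close>

definition rcomp :: "(nat \<Rightarrow> nat) set \<Rightarrow> (nat \<Rightarrow> nat) \<Rightarrow> bool" where
  "rcomp Os f \<longleftrightarrow> (\<exists>p. \<forall>orc\<in>Os. \<forall>x. eval orc p x (f x))"

definition rdec :: "(nat \<Rightarrow> nat) set \<Rightarrow> (nat \<Rightarrow> bool) \<Rightarrow> bool" where
  "rdec Os P \<longleftrightarrow> rcomp Os (\<lambda>x. if P x then 1 else 0)"

lemma rcomp_comp: "rcomp Os f \<Longrightarrow> rcomp Os g \<Longrightarrow> rcomp Os (\<lambda>x. f (g x))"
  unfolding rcomp_def by (meson eComp)

lemma rcomp_oracle: "rcomp Os f \<Longrightarrow> Os \<subseteq> {orc} \<Longrightarrow> rcomp Os (\<lambda>x. orc (f x))"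
  by (rule rcomp_comp[of Os orc]) (auto simp: rcomp_def intro: eOrc)

lemma rcomp_pair: "rcomp Os f \<Longrightarrow> rcomp Os g \<Longrightarrow> rcomp Os (\<lambda>x. pr (f x) (g x))"
  unfolding rcomp_def by (meson ePair)

lemma rcomp_fst: "rcomp Os f \<Longrightarrow> rcomp Os (\<lambda>x. p1 (f x))"
  by (rule rcomp_comp[of Os p1]) (auto simp: rcomp_def intro: eFst)

lemma rcomp_snd: "rcomp Os f \<Longrightarrow> rcomp Os (\<lambda>x. p2 (f x))"
  by (rule rcomp_comp[of Os p2]) (auto simp: rcomp_def intro: eSnd)

lemma eval_id: "eval orc (RPair RFst RSnd) x x"
  using ePair[OF eFst eSnd] by (metis prod.collapse prod_decode_inverse)

lemma rcomp_id: "rcomp Os (\<lambda>x. x)"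
  unfolding rcomp_def using eval_id by blast

lemma rcomp_Suc: "rcomp Os f \<Longrightarrow> rcomp Os (\<lambda>x. Suc (f x))"
  by (rule rcomp_comp[of Os Suc]) (auto simp: rcomp_def intro: eSucc)

primrec cst :: "nat \<Rightarrow> rf" where
  "cst 0 = RZero"
| "cst (Suc n) = RComp RSucc (cst n)"

lemma eval_cst: "eval orc (cst n) x n"
  by (induction n) (auto intro: eZero eComp eSucc)

lemma rcomp_const: "rcomp Os (\<lambda>x. c)"
  unfolding rcomp_def using eval_cst by blast

text \<open>\<open>RRec\<close> hands its step program the nested pair \<open>pr x (pr n z)\<close>,
  hence the unpacking of \<open>t\<close> in the hypothesis on \<open>g\<close>. The arithmetic
  rules and definition by cases below come from writing a function as
  \<open>rec_nat\<close>.\<close>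

lemma rcomp_rec:
  assumes "rcomp Os f" "rcomp Os (\<lambda>t. g (p1 t) (p1 (p2 t)) (p2 (p2 t)))" "rcomp Os h"
  shows "rcomp Os (\<lambda>x. rec_nat (f x) (g x) (h x))"
proof -
  obtain p q where p: "\<forall>orc\<in>Os. \<forall>x. eval orc p x (f x)"
    and q: "\<forall>orc\<in>Os. \<forall>t. eval orc q t (g (p1 t) (p1 (p2 t)) (p2 (p2 t)))"
    using assms(1,2) unfolding rcomp_def by metis
  have "eval orc (RRec p q) (pr x n) (rec_nat (f x) (g x) n)" if "orc \<in> Os" for orc x n
  proof (induction n)
    case 0 show ?case using p that by (auto intro: eRec0)
  next
    case (Suc n)
    have "eval orc q (pr x (pr n (rec_nat (f x) (g x) n))) (g x n (rec_nat (f x) (g x) n))"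
      using q that by (metis fst_conv prod_encode_inverse snd_conv)
    from eRecS[OF Suc this] show ?case by simp
  qed
  then have "rcomp Os (\<lambda>t. rec_nat (f (p1 t)) (g (p1 t)) (p2 t))"
    unfolding rcomp_def by (metis prod.collapse prod_decode_inverse)
  from rcomp_comp[OF this rcomp_pair[OF rcomp_id assms(3)]] show ?thesis by simp
qed

lemma rcomp_funpow:
  assumes "rcomp Os f" "rcomp Os n" "rcomp Os c"
  shows "rcomp Os (\<lambda>x. (f ^^ n x) (c x))"
proof -
  have eq: "(f ^^ n) c = rec_nat c (\<lambda>_. f) n" for n c by (induction n) auto
  show ?thesis unfolding eq
    by (rule rcomp_rec) (intro assms rcomp_comp[OF assms(1)] rcomp_snd rcomp_id)+
qed

lemma rcomp_add: "rcomp Os f \<Longrightarrow> rcomp Os g \<Longrightarrow> rcomp Os (\<lambda>x. f x + g x)"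
proof -
  have eq: "a + b = rec_nat a (\<lambda>_. Suc) b" for a b :: nat by (induction b) auto
  assume f: "rcomp Os f" and g: "rcomp Os g"
  show ?thesis unfolding eq by (intro rcomp_rec f g rcomp_Suc rcomp_snd rcomp_id)
qed

lemma rcomp_pred: "rcomp Os f \<Longrightarrow> rcomp Os (\<lambda>x. f x - Suc 0)"
proof -
  have eq: "a - Suc 0 = rec_nat 0 (\<lambda>n _. n) a" for a :: nat by (cases a) auto
  assume "rcomp Os f"
  then show ?thesis unfolding eq by (intro rcomp_rec rcomp_const rcomp_fst rcomp_snd rcomp_id)
qed

lemma rcomp_diff: "rcomp Os f \<Longrightarrow> rcomp Os g \<Longrightarrow> rcomp Os (\<lambda>x. f x - g x)"
proof -
  have eq: "a - b = rec_nat a (\<lambda>_ z. z - Suc 0) b" for a b :: nat by (induction b) auto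
  assume f: "rcomp Os f" and g: "rcomp Os g"
  show ?thesis by (subst eq, intro rcomp_rec f g rcomp_pred rcomp_snd rcomp_id)
qed

lemma rcomp_mult: "rcomp Os f \<Longrightarrow> rcomp Os g \<Longrightarrow> rcomp Os (\<lambda>x. f x * g x)"
proof -
  have eq: "a * b = rec_nat 0 (\<lambda>_ z. z + a) b" for a b :: nat by (induction b) auto
  assume f: "rcomp Os f" and g: "rcomp Os g"
  show ?thesis unfolding eq
    by (intro rcomp_rec g rcomp_const rcomp_add rcomp_comp[OF f] rcomp_fst rcomp_snd rcomp_id)
qed

lemma rcomp_power: "rcomp Os f \<Longrightarrow> rcomp Os g \<Longrightarrow> rcomp Os (\<lambda>x. f x ^ g x)"
proof -
  have eq: "a ^ b = rec_nat 1 (\<lambda>_ z. a * z) b" for a b :: nat by (induction b) auto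
  assume f: "rcomp Os f" and g: "rcomp Os g"
  show ?thesis unfolding eq
    by (intro rcomp_rec g rcomp_const rcomp_mult rcomp_comp[OF f] rcomp_fst rcomp_snd rcomp_id)
qed

lemma rcomp_if:
  assumes "rdec Os P" "rcomp Os f" "rcomp Os g"
  shows "rcomp Os (\<lambda>x. if P x then f x else g x)"
proof -
  have eq: "(if b then u else v) = rec_nat v (\<lambda>_ _. u) (if b then 1 else 0)" for b and u v :: nat
    by simp
  show ?thesis
    by (subst eq, intro rcomp_rec assms(3) assms(1)[unfolded rdec_def] rcomp_comp[OF assms(2)] rcomp_fst rcomp_id)
qed

lemma rdec_eq0: "rcomp Os f \<Longrightarrow> rdec Os (\<lambda>x. f x = 0)"
proof -
  assume "rcomp Os f"
  then have "rcomp Os (\<lambda>x. 1 - f x)" by (intro rcomp_diff rcomp_const)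
  moreover have "(\<lambda>x. 1 - f x) = (\<lambda>x. if f x = 0 then 1 else 0)" by auto
  ultimately show ?thesis by (simp add: rdec_def)
qed

lemma rdec_eq: "rcomp Os f \<Longrightarrow> rcomp Os g \<Longrightarrow> rdec Os (\<lambda>x. f x = g x)"
proof -
  assume "rcomp Os f" "rcomp Os g"
  then have "rdec Os (\<lambda>x. (f x - g x) + (g x - f x) = 0)" by (intro rdec_eq0 rcomp_add rcomp_diff)
  moreover have "(f x - g x) + (g x - f x) = 0 \<longleftrightarrow> f x = g x" for x by auto
  ultimately show ?thesis by simp
qed

lemma rdec_not: "rdec Os P \<Longrightarrow> rdec Os (\<lambda>x. \<not> P x)"
proof -
  assume "rdec Os P"
  then have "rcomp Os (\<lambda>x. if P x then 0 else 1)" by (intro rcomp_if rcomp_const)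
  moreover have "(if P x then 0 else 1) = (if \<not> P x then 1 else (0::nat))" for x by simp
  ultimately show ?thesis unfolding rdec_def by simp
qed

lemma rdec_and: "rdec Os P \<Longrightarrow> rdec Os Q \<Longrightarrow> rdec Os (\<lambda>x. P x \<and> Q x)"
proof -
  assume P: "rdec Os P" and Q: "rdec Os Q"
  have "rcomp Os (\<lambda>x. if P x then (if Q x then 1 else 0) else 0)"
    by (intro rcomp_if P Q rcomp_const)
  moreover have "(if P x then (if Q x then 1 else 0) else 0) = (if P x \<and> Q x then 1 else (0::nat))" for x
    by simp
  ultimately show ?thesis unfolding rdec_def by simp
qed

lemma rdec_or: "rdec Os P \<Longrightarrow> rdec Os Q \<Longrightarrow> rdec Os (\<lambda>x. P x \<or> Q x)"
  using rdec_not[OF rdec_and[OF rdec_not rdec_not], of Os P Q] by simp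

lemma rdec_comp: "rdec Os P \<Longrightarrow> rcomp Os g \<Longrightarrow> rdec Os (\<lambda>x. P (g x))"
  unfolding rdec_def by (rule rcomp_comp)

lemma rdec_all_less:
  assumes "rdec Os (\<lambda>t. P (p1 t) (p2 t))" "rcomp Os b"
  shows "rdec Os (\<lambda>x. \<forall>n<b x. P x n)"
proof -
  have eq: "(if \<forall>n<m. P x n then 1 else 0) = rec_nat 1 (\<lambda>n z. if P x n then z else 0) m" for x m
    by (induction m) (auto simp: less_Suc_eq)
  have "rdec Os (\<lambda>t. P (p1 (pr (p1 t) (p1 (p2 t)))) (p2 (pr (p1 t) (p1 (p2 t)))))"
    by (intro rdec_comp[OF assms(1)] rcomp_pair rcomp_fst rcomp_snd rcomp_id)
  then have *: "rdec Os (\<lambda>t. P (p1 t) (p1 (p2 t)))" by simp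
  show ?thesis unfolding rdec_def eq
    by (intro rcomp_rec * assms(2) rcomp_const rcomp_if rcomp_snd rcomp_id)
qed

text \<open>Unbounded search: \<open>RMu\<close> stops at the first zero of its body, so it is run
  on the characteristic function of the negation. Existence for every \<open>x\<close> makes the
  search total.\<close>

lemma rcomp_Least:
  assumes "rdec Os (\<lambda>t. P (p1 t) (p2 t))" "\<And>x. \<exists>n. P x n"
  shows "rcomp Os (\<lambda>x. LEAST n. P x n)"
proof -
  obtain p where p: "\<forall>orc\<in>Os. \<forall>t. eval orc p t (if \<not> P (p1 t) (p2 t) then 1 else 0)"
    using rdec_not[OF assms(1)] unfolding rdec_def rcomp_def by metis
  have p': "eval orc p (pr x n) (if \<not> P x n then 1 else 0)" if "orc \<in> Os" for orc x n
    using p[rule_format, OF that, of "pr x n"] by simp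
  have "eval orc (RMu p) x (LEAST n. P x n)" if "orc \<in> Os" for orc x
  proof (rule eMu)
    have "P x (LEAST n. P x n)" using assms(2) by (rule LeastI_ex)
    then show "eval orc p (pr x (LEAST n. P x n)) 0" using p'[OF that, of x "LEAST n. P x n"] by simp
    show "\<forall>m<(LEAST n. P x n). \<exists>k. k \<noteq> 0 \<and> eval orc p (pr x m) k"
    proof (intro allI impI)
      fix m assume "m < (LEAST n. P x n)"
      then have "\<not> P x m" by (rule not_less_Least)
      then show "\<exists>k. k \<noteq> 0 \<and> eval orc p (pr x m) k" using p'[OF that, of x m] by auto
    qed
  qed
  then show ?thesis unfolding rcomp_def by blast
qed

lemmas rc = rcomp_id rcomp_const rcomp_pair rcomp_fst rcomp_snd rcomp_Suc rcomp_add rcomp_pred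
  rcomp_diff rcomp_mult rcomp_power rcomp_if rdec_eq rdec_not rdec_and rdec_or

section \<open>Parametrisation of programs (the s-m-n construction)\<close>

definition smn :: "rf \<Rightarrow> nat \<Rightarrow> nat" where
  "smn p x = enc (RComp p (RPair (cst x) (RPair RFst RSnd)))"

lemma phi_smn:
  assumes "\<forall>orc\<in>UNIV. \<forall>x. eval orc p x (f x)"
  shows "phi (smn p x) y = Some (f (pr x y))"
  unfolding smn_def
  by (rule phi_enc, rule eComp[OF ePair[OF eval_cst eval_id]]) (use assms in auto)

text \<open>The code of \<open>cst n\<close> arises from that of \<open>RZero\<close> by composing
  \<open>n\<close> times with \<open>RSucc\<close> (tag 5), a primitive recursion on
  \<open>n\<close>.\<close>

lemma rcomp_smn: "rcomp Os f \<Longrightarrow> rcomp Os (\<lambda>x. smn p (f x))"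
proof -
  assume f: "rcomp Os f"
  have eq: "enc (cst n) = rec_nat (enc RZero) (\<lambda>_ z. pr 5 (pr (enc RSucc) z)) n" for n
    by (induction n) auto
  have "rcomp Os (\<lambda>x. enc (cst (f x)))"
    unfolding eq by (intro rcomp_rec f rc)
  then show ?thesis unfolding smn_def enc.simps by (intro rc)
qed

section \<open>A universal machine\<close>

text \<open>A state is either \<open>evs c v K\<close> (run the program with code \<open>c\<close> on \<open>v\<close>) or \<open>rets v K\<close>
  (return \<open>v\<close>), where \<open>K\<close> is a stack of pending continuations coded as a list.\<close>

definition push :: "nat \<Rightarrow> nat \<Rightarrow> nat" where "push k K = Suc (pr k K)"
definition evs :: "nat \<Rightarrow> nat \<Rightarrow> nat \<Rightarrow> nat" where "evs c v K = pr 0 (pr c (pr v K))"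
definition rets :: "nat \<Rightarrow> nat \<Rightarrow> nat" where "rets v K = pr 1 (pr 0 (pr v K))"

text \<open>The cases follow the constructor tags of \<open>enc\<close>. The last default answers 0,
  which is right for \<open>ROrc\<close> under the zero oracle and arbitrary for tags that belong to
  no program.\<close>

definition step_eval :: "nat \<Rightarrow> nat \<Rightarrow> nat \<Rightarrow> nat \<Rightarrow> nat" where
  "step_eval t c v K =
    (if t = 0 then rets 0 K
     else if t = 1 then rets (Suc v) K
     else if t = 2 then rets (p1 v) K
     else if t = 3 then rets (p2 v) K
     else if t = 4 then evs (p1 c) v (push (pr 0 (pr (p2 c) v)) K)
     else if t = 5 then evs (p2 c) v (push (pr 2 (p1 c)) K)
     else if t = 6 then
       (if p2 v = 0 then evs (p1 c) (p1 v) K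
        else evs (pr 6 c) (pr (p1 v) (p2 v - Suc 0))
               (push (pr 3 (pr (p2 c) (pr (p1 v) (p2 v - Suc 0)))) K))
     else if t = 7 then evs c (pr v 0) (push (pr 4 (pr c (pr v 0))) K)
     else rets 0 K)"

text \<open>Frame 0 waits for the first component of a pair, 1 for the second with the first stored,
  2 for the inner value of a composition, 3 for the previous value of a recursion, 4 for the test of
  a candidate in a minimisation.\<close>

definition step_ret :: "nat \<Rightarrow> nat \<Rightarrow> nat \<Rightarrow> nat \<Rightarrow> nat" where
  "step_ret t k v K =
    (if t = 0 then evs (p1 k) (p2 k) (push (pr 1 v) K)
     else if t = 1 then rets (pr k v) K
     else if t = 2 then evs k v K
     else if t = 3 then evs (p1 k) (pr (p1 (p2 k)) (pr (p2 (p2 k)) v)) K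
     else if v = 0 then rets (p2 (p2 k)) K
     else evs (p1 k) (pr (p1 (p2 k)) (Suc (p2 (p2 k))))
            (push (pr 4 (pr (p1 k) (pr (p1 (p2 k)) (Suc (p2 (p2 k)))))) K))"

definition final :: "nat \<Rightarrow> bool" where
  "final s \<longleftrightarrow> p1 s = 1 \<and> p2 (p2 (p2 s)) = 0"

definition result :: "nat \<Rightarrow> nat" where "result s = p1 (p2 (p2 s))"

text \<open>The dummy 0 in \<open>rets\<close> puts value and stack at the same positions in both
  kinds of state. A return state with empty stack is a fixed point; \<open>- Suc 0\<close> undoes
  the \<open>Suc\<close> of \<open>push\<close>.\<close>

definition step :: "nat \<Rightarrow> nat" where
  "step s =
    (if p1 s = 0 then step_eval (p1 (p1 (p2 s))) (p2 (p1 (p2 s))) (p1 (p2 (p2 s))) (p2 (p2 (p2 s)))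
     else if p2 (p2 (p2 s)) = 0 then s
     else step_ret (p1 (p1 (p2 (p2 (p2 s)) - Suc 0))) (p2 (p1 (p2 (p2 (p2 s)) - Suc 0)))
            (p1 (p2 (p2 s))) (p2 (p2 (p2 (p2 s)) - Suc 0)))"

lemma rdec_final: "rcomp Os f \<Longrightarrow> rdec Os (\<lambda>x. final (f x))"
  unfolding final_def by (intro rc)

lemma rcomp_result: "rcomp Os f \<Longrightarrow> rcomp Os (\<lambda>x. result (f x))"
  unfolding result_def by (intro rc)

lemma rcomp_push: "rcomp Os f \<Longrightarrow> rcomp Os g \<Longrightarrow> rcomp Os (\<lambda>x. push (f x) (g x))"
  unfolding push_def by (intro rc)

lemma rcomp_evs:
  "rcomp Os f \<Longrightarrow> rcomp Os g \<Longrightarrow> rcomp Os h \<Longrightarrow> rcomp Os (\<lambda>x. evs (f x) (g x) (h x))"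
  unfolding evs_def by (intro rc)

lemma rcomp_rets: "rcomp Os f \<Longrightarrow> rcomp Os g \<Longrightarrow> rcomp Os (\<lambda>x. rets (f x) (g x))"
  unfolding rets_def by (intro rc)

lemma rcomp_step: "rcomp Os step"
proof -
  have e: "rcomp Os (\<lambda>x. step_eval (f x) (g x) (h x) (k x))"
    if "rcomp Os f" "rcomp Os g" "rcomp Os h" "rcomp Os k" for f g h k
    unfolding step_eval_def by (intro that rc rcomp_push rcomp_evs rcomp_rets)
  have r: "rcomp Os (\<lambda>x. step_ret (f x) (g x) (h x) (k x))"
    if "rcomp Os f" "rcomp Os g" "rcomp Os h" "rcomp Os k" for f g h k
    unfolding step_ret_def by (intro that rc rcomp_push rcomp_evs rcomp_rets)
  have "rcomp Os (\<lambda>s. step s)"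
    unfolding step_def by (intro rc e r)
  then show ?thesis .
qed

definition reach :: "nat \<Rightarrow> nat \<Rightarrow> bool" where
  "reach s t \<longleftrightarrow> (\<exists>n. (step ^^ n) s = t)"

lemma reach_refl: "reach s s" unfolding reach_def by (rule exI[of _ 0]) simp

lemma reach_step: "reach (step s) t \<Longrightarrow> reach s t"
  unfolding reach_def by (auto intro: exI[of _ "Suc _"] simp: funpow_Suc_right simp del: funpow.simps)

lemma reach_trans: "reach s t \<Longrightarrow> reach t u \<Longrightarrow> reach s u"
  unfolding reach_def by (metis comp_apply funpow_add)

lemma step_states:
  "step (evs (pr t c) v K) = step_eval t c v K"
  "step (rets v (push (pr t k) K)) = step_ret t k v K"
  by (simp_all add: step_def evs_def rets_def push_def)

lemma step_evs:
  "step (evs (enc RZero) v K) = rets 0 K"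
  "step (evs (enc RSucc) v K) = rets (Suc v) K"
  "step (evs (enc RFst) v K) = rets (p1 v) K"
  "step (evs (enc RSnd) v K) = rets (p2 v) K"
  "step (evs (enc ROrc) v K) = rets 0 K"
  "step (evs (enc (RPair f g)) v K) = evs (enc f) v (push (pr 0 (pr (enc g) v)) K)"
  "step (evs (enc (RComp f g)) v K) = evs (enc g) v (push (pr 2 (enc f)) K)"
  "step (evs (enc (RRec f g)) (pr y 0) K) = evs (enc f) y K"
  "step (evs (enc (RRec f g)) (pr y (Suc n)) K) =
     evs (enc (RRec f g)) (pr y n) (push (pr 3 (pr (enc g) (pr y n))) K)"
  "step (evs (enc (RMu f)) v K) = evs (enc f) (pr v 0) (push (pr 4 (pr (enc f) (pr v 0))) K)"
  by (simp_all add: step_states step_eval_def)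

lemma step_rets:
  "step (rets v (push (pr 0 (pr c x)) K)) = evs c x (push (pr 1 v) K)"
  "step (rets v (push (pr 1 y) K)) = rets (pr y v) K"
  "step (rets v (push (pr 2 c) K)) = evs c v K"
  "step (rets v (push (pr 3 (pr c (pr y n))) K)) = evs c (pr y (pr n v)) K"
  "step (rets 0 (push (pr 4 (pr c (pr x n))) K)) = rets n K"
  "v \<noteq> 0 \<Longrightarrow> step (rets v (push (pr 4 (pr c (pr x n))) K)) =
     evs c (pr x (Suc n)) (push (pr 4 (pr c (pr x (Suc n)))) K)"
  by (simp_all add: step_states step_ret_def)

lemma step_final: "final s \<Longrightarrow> step s = s"
  by (simp add: final_def step_def)

lemma final_rets [simp]: "final (rets v 0)" "result (rets v K) = v"
  by (simp_all add: final_def rets_def result_def)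

lemma not_final: "\<not> final (evs c v K)" "\<not> final (rets v (push k K))"
  by (simp_all add: final_def rets_def evs_def push_def)

text \<open>Completeness of the machine. The stack \<open>K\<close> is arbitrary so that the
  induction hypothesis applies to subcomputations, which run with a frame pushed.\<close>

lemma eval_reach: "ceval p v y \<Longrightarrow> reach (evs (enc p) v K) (rets y K)"
proof (induction arbitrary: K rule: eval.induct)
  case (ePair f x y g z)
  show ?case
    by (rule reach_step, unfold step_evs, rule reach_trans, rule ePair.IH(1), rule reach_step,
        unfold step_rets, rule reach_trans, rule ePair.IH(2), rule reach_step, unfold step_rets,
        rule reach_refl)
next
  case (eComp g x y f z)
  show ?case
    by (rule reach_step, unfold step_evs, rule reach_trans, rule eComp.IH(1), rule reach_step,
        unfold step_rets, rule eComp.IH(2))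
next
  case (eRec0 f y z g)
  show ?case by (rule reach_step, unfold step_evs, rule eRec0.IH)
next
  case (eRecS f g y n z w)
  show ?case
    by (rule reach_step, unfold step_evs, rule reach_trans, rule eRecS.IH(1), rule reach_step,
        unfold step_rets, rule eRecS.IH(2))
next
  case (eMu f x n)
  \<comment> \<open>All candidates below \<open>n\<close> are rejected, so by induction the machine
    arrives at the test of each \<open>i \<le> n\<close>.\<close>
  have "reach (evs (enc (RMu f)) x K)
          (evs (enc f) (pr x i) (push (pr 4 (pr (enc f) (pr x i))) K))" if "i \<le> n" for i
    using that
  proof (induction i)
    case 0
    show ?case by (rule reach_step, unfold step_evs, rule reach_refl)
  next
    case (Suc i)
    then obtain k where k: "k \<noteq> 0" "\<And>K. reach (evs (enc f) (pr x i) K) (rets k K)"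
      using eMu.IH(2) by (metis Suc_le_lessD)
    have "reach (evs (enc (RMu f)) x K) (rets k (push (pr 4 (pr (enc f) (pr x i))) K))"
      using Suc k(2) reach_trans Suc_leD by blast
    moreover have "reach (rets k (push (pr 4 (pr (enc f) (pr x i))) K))
        (evs (enc f) (pr x (Suc i)) (push (pr 4 (pr (enc f) (pr x (Suc i)))) K))"
      by (rule reach_step, unfold step_rets(6)[OF k(1)], rule reach_refl)
    ultimately show ?case by (rule reach_trans)
  qed
  note start = this[OF le_refl]
  show ?case
    by (rule reach_trans, rule start, rule reach_trans, rule eMu.IH(1), rule reach_step, unfold step_rets,
        rule reach_refl)
qed (rule reach_step, simp only: step_evs reach_refl)+

lemma funpow_step:
  "\<not> final s \<Longrightarrow> final ((step ^^ n) s) \<Longrightarrow> \<exists>m<n. final ((step ^^ m) (step s))"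
  by (cases n) (auto simp: funpow_Suc_right simp del: funpow.simps(2))

text \<open>Soundness of the machine. The induction is on the number of steps, not on the program,
  since a recursion calls its own code and a minimisation restarts its body. The strict bound
  \<open>m < n\<close> lets the hypothesis be applied again to the rest of the run.\<close>

lemma final_eval:
  "final ((step ^^ n) (evs (enc p) v K)) \<Longrightarrow> \<exists>y m. m < n \<and> ceval p v y \<and> final ((step ^^ m) (rets y K))"
proof (induction n arbitrary: p v K rule: less_induct)
  case (less n)
  obtain n1 where n1: "n1 < n" "final ((step ^^ n1) (step (evs (enc p) v K)))"
    using funpow_step[OF not_final(1) less.prems] by blast
  have ev: "\<exists>y m'. m' < m \<and> ceval p v y \<and> final ((step ^^ m') (rets y K))"
    if "final ((step ^^ m) (evs (enc p) v K))" "m \<le> n1" for m p v K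
    using less.IH[of m p v K] that n1(1) by simp
  have rt: "\<exists>m'<m. final ((step ^^ m') (step (rets v (push k K))))"
    if "final ((step ^^ m) (rets v (push k K)))" for m v k K
    by (rule funpow_step[OF not_final(2) that])
  show ?case
  proof (cases p)
    case (RPair f g)
    obtain y m where y: "m < n1" "ceval f v y" "final ((step ^^ m) (rets y (push (pr 0 (pr (enc g) v)) K)))"
      using ev[OF n1(2)[unfolded RPair step_evs]] by auto
    obtain m1 where m1: "m1 < m" "final ((step ^^ m1) (evs (enc g) v (push (pr 1 y) K)))"
      using rt[OF y(3)] unfolding step_rets by auto
    obtain z m2 where z: "m2 < m1" "ceval g v z" "final ((step ^^ m2) (rets z (push (pr 1 y) K)))"
      using ev[OF m1(2)] y m1 by auto
    obtain m3 where "m3 < m2" "final ((step ^^ m3) (rets (pr y z) K))"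
      using rt[OF z(3)] unfolding step_rets by auto
    then show ?thesis using RPair ePair[OF y(2) z(2)] n1(1) y(1) m1(1) z(1)
      by (intro exI[of _ "pr y z"] exI[of _ m3]) auto
  next
    case (RComp f g)
    obtain y m where y: "m < n1" "ceval g v y" "final ((step ^^ m) (rets y (push (pr 2 (enc f)) K)))"
      using ev[OF n1(2)[unfolded RComp step_evs]] by auto
    obtain m1 where m1: "m1 < m" "final ((step ^^ m1) (evs (enc f) y K))"
      using rt[OF y(3)] unfolding step_rets by auto
    obtain z m2 where z: "m2 < m1" "ceval f y z" "final ((step ^^ m2) (rets z K))"
      using ev[OF m1(2)] y m1 by auto
    then show ?thesis using RComp eComp[OF y(2) z(2)] n1(1) y(1) m1(1)
      by (intro exI[of _ z] exI[of _ m2]) auto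
  next
    case (RRec f g)
    obtain y i where v: "v = pr y i" by (metis prod.collapse prod_decode_inverse)
    show ?thesis
    proof (cases i)
      case 0
      show ?thesis using ev[OF n1(2)[unfolded RRec v 0 step_evs]] n1(1)
        unfolding RRec v 0 by (meson eRec0 less_trans le_refl)
    next
      case (Suc j)
      obtain z m where z: "m < n1" "ceval (RRec f g) (pr y j) z"
        "final ((step ^^ m) (rets z (push (pr 3 (pr (enc g) (pr y j))) K)))"
        using ev[OF n1(2)[unfolded RRec v Suc step_evs]] by auto
      obtain m1 where m1: "m1 < m" "final ((step ^^ m1) (evs (enc g) (pr y (pr j z)) K))"
        using rt[OF z(3)] unfolding step_rets by auto
      obtain w m2 where w: "m2 < m1" "ceval g (pr y (pr j z)) w" "final ((step ^^ m2) (rets w K))"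
        using ev[OF m1(2)] z m1 by auto
      then show ?thesis using RRec v Suc eRecS[OF z(2) w(2)] n1(1) z(1) m1(1)
        by (intro exI[of _ w] exI[of _ m2]) auto
    qed
  next
    case (RMu f)
    \<comment> \<open>Inner induction on the remaining steps with the candidate \<open>i\<close>
      varying: a rejected candidate leaves fewer steps for \<open>Suc i\<close>.\<close>
    have "\<exists>y m'. m' < n \<and> ceval (RMu f) v y \<and> final ((step ^^ m') (rets y K))"
      if "final ((step ^^ m) (evs (enc f) (pr v i) (push (pr 4 (pr (enc f) (pr v i))) K)))" "m \<le> n1"
        "\<forall>j<i. \<exists>k. k \<noteq> 0 \<and> ceval f (pr v j) k" for m i
      using that
    proof (induction m arbitrary: i rule: less_induct)
      case (less m)
      obtain k m1 where k: "m1 < m" "ceval f (pr v i) k"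
        "final ((step ^^ m1) (rets k (push (pr 4 (pr (enc f) (pr v i))) K)))"
        using ev[OF less.prems(1,2)] by auto
      obtain m2 where m2: "m2 < m1" "final ((step ^^ m2) (step (rets k (push (pr 4 (pr (enc f) (pr v i))) K))))"
        using rt[OF k(3)] by auto
      show ?case
      proof (cases "k = 0")
        case True
        have "ceval (RMu f) v i" using eMu k(2) True less.prems(3) by simp
        then show ?thesis using m2 k(1) less.prems(2) n1(1) unfolding True step_rets
          by (intro exI[of _ i] exI[of _ m2]) auto
      next
        case False
        show ?thesis
        proof (rule less.IH[of m2 "Suc i"])
          show "\<forall>j<Suc i. \<exists>k. k \<noteq> 0 \<and> ceval f (pr v j) k"
            using less.prems(3) k(2) False by (metis less_Suc_eq)
        qed (use m2 k(1) less.prems(2) False in \<open>auto simp: step_rets\<close>)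
      qed
    qed
    from this[OF n1(2)[unfolded RMu step_evs]] show ?thesis using RMu by simp
  qed (use n1 in \<open>auto simp only: step_evs intro: eval.intros\<close>)
qed

lemma funpow_final: "final ((step ^^ n) s) \<Longrightarrow> n \<le> m \<Longrightarrow> (step ^^ m) s = (step ^^ n) s"
  by (induction m) (auto simp: le_Suc_eq step_final)

lemma eval_final:
  assumes "ceval p v y"
  obtains n where "(step ^^ n) (evs (enc p) v 0) = rets y 0"
  using eval_reach[OF assms] unfolding reach_def by blast

lemma final_result:
  assumes "final ((step ^^ n) (evs (enc p) v 0))"
  shows "ceval p v (result ((step ^^ n) (evs (enc p) v 0)))"
proof -
  obtain y where y: "ceval p v y" using final_eval[OF assms] by blast
  obtain m where m: "(step ^^ m) (evs (enc p) v 0) = rets y 0" using eval_final[OF y] .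
  \<comment> \<open>Final states are fixed, so the shorter of the two runs has already reached the
    state in which the longer one ends.\<close>
  have "(step ^^ n) (evs (enc p) v 0) = rets y 0"
    using m assms funpow_final[of n "evs (enc p) v 0" m] funpow_final[of m "evs (enc p) v 0" n]
    by (metis final_rets(1) nat_le_linear)
  with y show ?thesis by simp
qed

text \<open>Not every number codes a program; the second machine keeps a stack of numbers that are
  still to be recognised as codes, and gets stuck on a number that is not a code.\<close>

definition check :: "nat \<Rightarrow> nat" where
  "check w = (let c = p1 (w - Suc 0); K = p2 (w - Suc 0) in
    (if w = 0 then 0
     else if p1 c = 4 \<or> p1 c = 5 \<or> p1 c = 6 then push (p1 (p2 c)) (push (p2 (p2 c)) K)
     else if p1 c = 7 then push (p2 c) K
     else if p2 c = 0 \<and> (p1 c = 0 \<or> p1 c = 1 \<or> p1 c = 2 \<or> p1 c = 3 \<or> p1 c = 8) then K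
     else w))"

lemma rcomp_check: "rcomp Os check"
proof -
  have "rcomp Os (\<lambda>w. check w)" unfolding check_def Let_def by (intro rc rcomp_push)
  then show ?thesis .
qed

lemma check_push:
  "check (push (enc RZero) K) = K" "check (push (enc RSucc) K) = K" "check (push (enc RFst) K) = K"
  "check (push (enc RSnd) K) = K" "check (push (enc ROrc) K) = K"
  "check (push (enc (RPair f g)) K) = push (enc f) (push (enc g) K)"
  "check (push (enc (RComp f g)) K) = push (enc f) (push (enc g) K)"
  "check (push (enc (RRec f g)) K) = push (enc f) (push (enc g) K)"
  "check (push (enc (RMu f)) K) = push (enc f) K"
  by (simp_all add: check_def push_def)

lemma check_enc: "\<exists>n. (check ^^ n) (push (enc p) K) = K"
proof (induction p arbitrary: K)
  have step1: "\<exists>n. (check ^^ n) s = K" if "\<exists>n. (check ^^ n) (check s) = K" for s K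
    using that by (metis comp_apply funpow_Suc_right)
  have trans: "\<exists>n. (check ^^ n) s = K" if "\<exists>n. (check ^^ n) s = t" "\<exists>n. (check ^^ n) t = K" for s t K
    using that by (metis comp_apply funpow_add)
  have refl: "\<exists>n. (check ^^ n) s = s" for s
    by (rule exI[of _ 0]) simp
  {
    case (RPair f g)
    show ?case by (rule step1, unfold check_push, rule trans, rule RPair, rule RPair)
  next
    case (RComp f g)
    show ?case by (rule step1, unfold check_push, rule trans, rule RComp, rule RComp)
  next
    case (RRec f g)
    show ?case by (rule step1, unfold check_push, rule trans, rule RRec, rule RRec)
  next
    case (RMu f)
    show ?case by (rule step1, unfold check_push, rule RMu)
  }
qed (rule exI[of _ 1], simp add: check_push del: enc.simps)+

text \<open>Backwards along the run: if all stack entries after a move are codes, so are those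
  before it, since the removed number is rebuilt from the components that were pushed, and a stuck
  move changes nothing.\<close>

lemma check_sound: "(check ^^ n) w = 0 \<Longrightarrow> set (list_decode w) \<subseteq> range enc"
proof (induction n arbitrary: w)
  case (Suc n)
  then have IH: "set (list_decode (check w)) \<subseteq> range enc" by (simp add: funpow_Suc_right del: funpow.simps)
  show ?case
  proof (cases w)
    case (Suc u)
    obtain c K where u: "u = pr c K" by (metis prod.collapse prod_decode_inverse)
    obtain t d where c: "c = pr t d" by (metis prod.collapse prod_decode_inverse)
    obtain f g where d: "d = pr f g" by (metis prod.collapse prod_decode_inverse)
    have dec: "list_decode w = c # list_decode K" by (simp add: Suc u)
    show ?thesis
    proof (cases "t = 4 \<or> t = 5 \<or> t = 6")
      case True
      then have "check w = push f (push g K)" by (auto simp: check_def Suc u c d)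
      with IH have "f \<in> range enc" "g \<in> range enc" "set (list_decode K) \<subseteq> range enc"
        by (auto simp: push_def)
      then obtain p q where "f = enc p" "g = enc q" "set (list_decode K) \<subseteq> range enc" by blast
      with True have "c = enc (RPair p q) \<or> c = enc (RComp p q) \<or> c = enc (RRec p q)"
        by (auto simp: c d)
      then have "c \<in> range enc" by blast
      then show ?thesis using \<open>set (list_decode K) \<subseteq> range enc\<close> unfolding dec by auto
    next
      case F: False
      show ?thesis
      proof (cases "t = 7")
        case True
        then have "check w = push d K" by (auto simp: check_def Suc u c)
        with IH obtain p where "d = enc p" "set (list_decode K) \<subseteq> range enc"
          by (auto simp: push_def)
        with True have "c = enc (RMu p)" by (simp add: c)
        then have "c \<in> range enc" by blast
        then show ?thesis using \<open>set (list_decode K) \<subseteq> range enc\<close> unfolding dec by auto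
      next
        case F2: False
        show ?thesis
        proof (cases "d = 0 \<and> (t = 0 \<or> t = 1 \<or> t = 2 \<or> t = 3 \<or> t = 8)")
          case True
          then have "check w = K" using F F2 by (auto simp: check_def Suc u c)
          with IH have K: "set (list_decode K) \<subseteq> range enc" by simp
          have "c = enc RZero \<or> c = enc RSucc \<or> c = enc RFst \<or> c = enc RSnd \<or> c = enc ROrc"
            using True by (auto simp: c)
          then have "c \<in> range enc" by blast
          then show ?thesis using K unfolding dec by auto
        next
          case False
          then have "check w = w" using F F2 by (auto simp: check_def Suc u c)
          with IH show ?thesis by simp
        qed
      qed
    qed
  qed simp
qed simp

text \<open>The recognition run guards against numbers that are no codes, on which the simulator may
  halt as well. A single bound \<open>s\<close> serves both machines, as both stay put once they
  have succeeded.\<close>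

definition halts_in :: "nat \<Rightarrow> nat \<Rightarrow> bool" where
  "halts_in x s \<longleftrightarrow> (check ^^ s) (push x 0) = 0 \<and> final ((step ^^ s) (evs x x 0))"

lemma rdec_halts_in:
  "rcomp Os f \<Longrightarrow> rcomp Os g \<Longrightarrow> rdec Os (\<lambda>x. halts_in (f x) (g x))"
  unfolding halts_in_def
  by (intro rdec_final rcomp_funpow rcomp_step rcomp_check rcomp_evs rcomp_push rc)

lemma halting_set_iff: "x \<in> halting_set \<longleftrightarrow> (\<exists>s. halts_in x s)"
proof
  assume "x \<in> halting_set"
  then obtain y where y: "phi x x = Some y" by (auto simp: halting_set_def)
  then obtain p where x: "x = enc p" using phi_noncode by (metis option.distinct(1))
  then have "ceval p x y" using y by (simp add: phi_eq_Some_iff)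
  then obtain n where n: "(step ^^ n) (evs x x 0) = rets y 0" using eval_final x by metis
  obtain m where m: "(check ^^ m) (push x 0) = 0" using check_enc x by metis
  have "(check ^^ k) 0 = 0" for k by (induction k) (auto simp: check_def)
  with m have "(check ^^ (n + m)) (push x 0) = 0" by (simp add: funpow_add)
  moreover have "final ((step ^^ (n + m)) (evs x x 0))"
    using n funpow_final[of n "evs x x 0" "n + m"] by simp
  ultimately show "\<exists>s. halts_in x s" unfolding halts_in_def by blast
next
  assume "\<exists>s. halts_in x s"
  then obtain s where s: "(check ^^ s) (push x 0) = 0" "final ((step ^^ s) (evs x x 0))"
    unfolding halts_in_def by blast
  from check_sound[OF s(1)] obtain p where "x = enc p" by (auto simp: push_def)
  with final_result[of s p x] s(2) have "ceval (prog x) x (result ((step ^^ s) (evs x x 0)))" by simp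
  then have "phi x x \<noteq> None" by (simp flip: phi_eq_Some_iff)
  then show "x \<in> halting_set" by (simp add: halting_set_def)
qed

text \<open>The index may depend on the oracle while the simulated computation does not. Definedness
  forces each \<open>k x\<close> to be a code, so the simulator is faithful and the search for a
  halting time ends.\<close>

lemma rcomp_phi:
  assumes "rcomp Os k" "\<And>x. phi (k x) v \<noteq> None"
  shows "rcomp Os (\<lambda>x. the (phi (k x) v))"
proof -
  define M where "M x n = (step ^^ n) (evs (k x) v 0)" for x n
  have M: "\<exists>n. final (M x n)" "final (M x n) \<Longrightarrow> the (phi (k x) v) = result (M x n)" for x n
  proof -
    obtain p where p: "k x = enc p" using assms(2) phi_noncode by metis
    obtain y where "phi (k x) v = Some y" using assms(2) by blast
    then have "ceval p v y" using p by (simp add: phi_eq_Some_iff)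
    then show "\<exists>n. final (M x n)" unfolding M_def p using eval_final by (metis final_rets(1))
    show "the (phi (k x) v) = result (M x n)" if "final (M x n)"
      using phi_enc[OF final_result] that unfolding M_def p by simp
  qed
  have rM: "rcomp Os (\<lambda>x. M (f x) (g x))" if "rcomp Os f" "rcomp Os g" for f g
    unfolding M_def
    by (intro rcomp_funpow rcomp_step rcomp_evs that rcomp_comp[OF assms(1)] rc)
  have eq: "the (phi (k x) v) = result (M x (LEAST n. final (M x n)))" for x
    using M(1)[of x, THEN LeastI_ex] by (rule M(2))
  show ?thesis unfolding eq
    by (intro rcomp_result rM rcomp_Least rdec_final rc M(1))
qed

section \<open>The two ambient groups\<close>

type_synonym vec = "int \<times> int \<times> rat"

definition scl :: "int \<Rightarrow> vec \<Rightarrow> vec" where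
  "scl k u = (k * fst u, k * fst (snd u), of_int k * snd (snd u))"

definition dyadic :: "rat \<Rightarrow> bool" where
  "dyadic z \<longleftrightarrow> (\<exists>m j. z = of_int m / 2 ^ j)"

definition big :: "vec set" where "big = {(x, v, z). dyadic z}"
text \<open>This is the group generated by \<open>avec\<close> and \<open>bvec\<close>: since
  \<open>v\<close> is an integer, the equation makes the dyadic \<open>z\<close> an integer
  (\<open>dyadic_17\<close>). A linear equation is easy to decide on codes.\<close>

definition small :: "vec set" where "small = {(x, v, z). dyadic z \<and> of_int v = - 17 * z}"

definition TA :: "vec set" where "TA = {(x, v, z). v = 0 \<and> z = 0}"
definition TB :: "vec set" where "TB = {(x, v, z). of_int v = - 17 * z \<and> of_int x = 6 * z}"
definition TG :: "vec set" where "TG = {(x, v, z). x = 0}"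
definition TH :: "vec set" where "TH = {(x, v, z). v = - 3 * x}"

definition avec :: vec where "avec = (1, 0, 0)"
definition bvec :: vec where "bvec = (6, - 17, 1)"
text \<open>\<open>gvec\<close> is \<open>bvec\<close> minus 6 times \<open>avec\<close>, and
  \<open>hvec\<close> is \<open>avec\<close> minus 3 times \<open>bvec\<close>; they generate
  \<open>small \<inter> TG\<close> and \<open>small \<inter> TH\<close>.\<close>

definition gvec :: vec where "gvec = (0, - 17, 1)"
definition hvec :: vec where "hvec = (- 17, 51, - 3)"

definition additive_set :: "vec set \<Rightarrow> bool" where
  "additive_set T \<longleftrightarrow> 0 \<in> T \<and> (\<forall>u\<in>T. \<forall>w\<in>T. u + w \<in> T) \<and> (\<forall>u\<in>T. - u \<in> T)"

lemma dyadic_of_int: "dyadic (of_int k)"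
  unfolding dyadic_def by (intro exI[of _ k] exI[of _ 0]) simp

lemma dyadic_0: "dyadic 0" and dyadic_1: "dyadic 1"
  using dyadic_of_int[of 0] dyadic_of_int[of 1] by simp_all

lemma dyadic_uminus: "dyadic z \<Longrightarrow> dyadic (- z)"
  unfolding dyadic_def by (metis minus_divide_left of_int_minus)

lemma dyadic_add: "dyadic y \<Longrightarrow> dyadic z \<Longrightarrow> dyadic (y + z)"
proof -
  assume "dyadic y" "dyadic z"
  then obtain m j n k where "y = of_int m / 2 ^ j" "z = of_int n / 2 ^ k"
    unfolding dyadic_def by blast
  then have "y + z = of_int (m * 2 ^ k + n * 2 ^ j) / 2 ^ (j + k)"
    by (simp add: add_divide_distrib power_add)
  then show ?thesis unfolding dyadic_def by blast
qed

lemma dyadic_div2: "dyadic z \<Longrightarrow> dyadic (z / 2 ^ k)"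
  unfolding dyadic_def by (metis divide_divide_eq_left power_add)

lemma dyadic_17: "dyadic z \<Longrightarrow> of_int v = - 17 * z \<Longrightarrow> \<exists>k. z = of_int k"
proof -
  assume "dyadic z" and v: "of_int v = - 17 * z"
  then obtain m j where z: "z = of_int m / 2 ^ j" unfolding dyadic_def by blast
  have "of_int (v * 2 ^ j) = (of_int (- 17 * m) :: rat)"
    using v by (simp add: z field_simps)
  then have "v * 2 ^ j = - 17 * m" by (rule of_int_eq_iff[THEN iffD1])
  then have "2 ^ j dvd 17 * m" by (metis dvd_minus_iff dvd_triv_right mult_minus_left)
  moreover have "coprime ((2::int) ^ j) 17" by simp
  ultimately have "2 ^ j dvd m" by (simp add: coprime_dvd_mult_right_iff)
  then obtain k where "m = 2 ^ j * k" ..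
  then show ?thesis by (intro exI[of _ k]) (simp add: z)
qed

lemma additive_sets:
  "additive_set big" "additive_set small" "additive_set TA" "additive_set TB" "additive_set TG" "additive_set TH"
  unfolding additive_set_def big_def small_def TA_def TB_def TG_def TH_def zero_prod_def
  by (auto simp: dyadic_0 dyadic_add dyadic_uminus)

lemma additive_inter: "additive_set S \<Longrightarrow> additive_set T \<Longrightarrow> additive_set (S \<inter> T)"
  unfolding additive_set_def by blast

lemma small_subset_big: "small \<subseteq> big"
  unfolding small_def big_def by auto

lemma TA_eq: "TA = range (\<lambda>k. scl k avec)"
  unfolding TA_def scl_def avec_def by auto

lemma TB_eq: "TB = range (\<lambda>k. scl k bvec)"
proof
  show "TB \<subseteq> range (\<lambda>k. scl k bvec)"
  proof
    fix u assume "u \<in> TB"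
    then obtain x v z where u: "u = (x, v, z)" "of_int v = - 17 * z" "of_int x = 6 * z"
      unfolding TB_def by auto
    \<comment> \<open>As \<open>3 * 6 - 17 = 1\<close>, this integer combination of the first two
      coordinates recovers \<open>z\<close>.\<close>
    then have z: "z = of_int (3 * x + v)" by simp
    then have "of_int x = (of_int (6 * (3 * x + v)) :: rat)" "of_int v = (of_int (- 17 * (3 * x + v)) :: rat)"
      using u by simp_all
    then have "x = 6 * (3 * x + v)" "v = - 17 * (3 * x + v)" by linarith+
    then have "u = scl (3 * x + v) bvec" using z by (simp add: u(1) scl_def bvec_def)
    then show "u \<in> range (\<lambda>k. scl k bvec)" by blast
  qed
qed (auto simp: TB_def scl_def bvec_def)

lemma TA_small: "TA \<subseteq> small" and TB_small: "TB \<subseteq> small"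
  unfolding TA_eq TB_eq
  by (auto simp: small_def scl_def avec_def bvec_def dyadic_0 dyadic_of_int)

lemma TA_TG: "TA \<inter> TG = {0}" and TB_TH: "TB \<inter> TH = {0}"
  by (auto simp: TA_def TG_def TB_def TH_def zero_prod_def)

text \<open>The coefficient of \<open>bvec\<close> in the splitting along \<open>TB\<close> and
  \<open>TH\<close>: the form \<open>v + 3 x\<close> vanishes on \<open>TH\<close> and equals 1 at
  \<open>bvec\<close>.\<close>

definition bcoord :: "vec \<Rightarrow> int" where "bcoord u = fst (snd u) + 3 * fst u"

lemma split_A: "u - scl (fst u) avec \<in> TG"
  by (cases u; simp add: scl_def avec_def TG_def)

lemma split_B: "u - scl (bcoord u) bvec \<in> TH"
  by (cases u; simp add: scl_def bvec_def TH_def bcoord_def)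

lemma scl_add: "scl (k + l) u = scl k u + scl l u"
  by (auto simp: scl_def ring_distribs)

lemma scl_0 [simp]: "scl 0 u = 0" by (simp add: scl_def zero_prod_def)
lemma scl_1 [simp]: "scl 1 u = u" by (simp add: scl_def)
lemma scl_minus: "scl (- k) u = - scl k u" by (auto simp: scl_def)
lemma scl_scl: "scl k (scl l u) = scl (k * l) u" by (auto simp: scl_def)

lemma scl_eq_0: "scl k u = 0 \<longleftrightarrow> k = 0 \<or> u = 0"
  by (cases u) (auto simp: scl_def zero_prod_def)

lemma additive_scl:
  assumes F: "\<And>u w. u \<in> T \<Longrightarrow> w \<in> T \<Longrightarrow> F (u + w) = F u + F w" and T: "additive_set T"
    and u: "u \<in> T"
  shows "scl k u \<in> T" "F (scl k u) = scl k (F u)"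
proof -
  have "F (0 + 0) = F 0 + F 0" by (rule F) (use T in \<open>auto simp: additive_set_def\<close>)
  then have F0: "F 0 = 0" by simp
  have nat: "scl (int n) u \<in> T \<and> F (scl (int n) u) = scl (int n) (F u)" for n
  proof (induction n)
    case 0 show ?case using T F0 by (simp add: additive_set_def)
  next
    case (Suc n)
    have s: "int (Suc n) = 1 + int n" by simp
    show ?case unfolding s scl_add using Suc u T F by (simp add: additive_set_def)
  qed
  have minus: "- w \<in> T \<and> F (- w) = - F w" if "w \<in> T" for w
  proof -
    have "- w \<in> T" using that T by (simp add: additive_set_def)
    moreover have "F (- w + w) = F (- w) + F w" by (rule F) (use that \<open>- w \<in> T\<close> in auto)
    ultimately show ?thesis using F0 by (simp add: eq_neg_iff_add_eq_0)
  qed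
  have "scl k u \<in> T \<and> F (scl k u) = scl k (F u)"
  proof (cases k)
    case (nonneg n) with nat show ?thesis by simp
  next
    case (neg n)
    then show ?thesis using nat[of "Suc n"] minus by (simp only: scl_minus)
  qed
  then show "scl k u \<in> T" "F (scl k u) = scl k (F u)" by auto
qed

section \<open>Isomorphisms between the complements in the small and in the big group\<close>

lemma small_TG: "small \<inter> TG = range (\<lambda>k. scl k gvec)"
proof
  show "small \<inter> TG \<subseteq> range (\<lambda>k. scl k gvec)"
  proof
    fix u assume "u \<in> small \<inter> TG"
    then obtain v z where u: "u = (0, v, z)" "dyadic z" "of_int v = - 17 * z"
      unfolding small_def TG_def by auto
    then obtain k where k: "z = of_int k" using dyadic_17 by blast
    then have "of_int v = (of_int (- 17 * k) :: rat)" using u by simp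
    then have "v = - 17 * k" by (rule of_int_eq_iff[THEN iffD1])
    then have "u = scl k gvec" by (simp add: u k scl_def gvec_def)
    then show "u \<in> range (\<lambda>k. scl k gvec)" by blast
  qed
qed (auto simp: small_def TG_def scl_def gvec_def dyadic_of_int)

lemma small_TH: "small \<inter> TH = range (\<lambda>k. scl k hvec)"
proof
  show "small \<inter> TH \<subseteq> range (\<lambda>k. scl k hvec)"
  proof
    fix u assume "u \<in> small \<inter> TH"
    then obtain x v z where u: "u = (x, v, z)" "dyadic z" "of_int v = - 17 * z" "v = - 3 * x"
      unfolding small_def TH_def by auto
    then obtain k where k: "z = of_int k" using dyadic_17 by blast
    then have "of_int v = (of_int (- 17 * k) :: rat)" using u by simp
    then have v: "v = - 17 * k" by (rule of_int_eq_iff[THEN iffD1])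
    with u have "17 * k = 3 * x" by simp
    \<comment> \<open>From \<open>17 * k = 3 * x\<close> and \<open>3 * 6 - 17 = 1\<close> it
      follows that \<open>3 * l = k\<close> and \<open>17 * l = x\<close>, so \<open>u\<close> is
      \<open>- l\<close> times \<open>hvec\<close>.\<close>
    define l where "l = 6 * k - x"
    have "k = 3 * l" "x = 17 * l" using \<open>17 * k = 3 * x\<close> by (simp_all add: l_def)
    then have "u = scl (- l) hvec" by (simp add: u(1,4) k scl_def hvec_def)
    then show "u \<in> range (\<lambda>k. scl k hvec)" by blast
  qed
next
  have "dyadic (of_int k * 3)" for k using dyadic_of_int[of "k * 3"] by simp
  then show "range (\<lambda>k. scl k hvec) \<subseteq> small \<inter> TH"
    by (auto simp: small_def TH_def scl_def hvec_def dyadic_uminus)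
qed

text \<open>A surjection between infinite cyclic groups sends a generator to a generator: if
  \<open>F gvec\<close> is \<open>k\<close> times \<open>hvec\<close> and \<open>l\<close> times
  \<open>gvec\<close> is a preimage of \<open>hvec\<close>, then \<open>l * k = 1\<close>.\<close>

lemma iso_small:
  assumes F: "\<And>u w. u \<in> small \<inter> TG \<Longrightarrow> w \<in> small \<inter> TG \<Longrightarrow> F (u + w) = F u + F w"
    and im: "F ` (small \<inter> TG) = small \<inter> TH"
  shows "F gvec = hvec \<or> F gvec = - hvec"
proof -
  have g: "gvec \<in> small \<inter> TG" unfolding small_TG by (metis rangeI scl_1)
  obtain k where k: "F gvec = scl k hvec" using im g unfolding small_TH by blast
  have "hvec \<in> F ` (small \<inter> TG)" unfolding im small_TH by (metis rangeI scl_1)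
  then obtain l where "hvec = F (scl l gvec)" unfolding small_TG by blast
  also have "\<dots> = scl (l * k) hvec"
    by (subst additive_scl(2)[where F = F and T = "small \<inter> TG"])
      (auto simp: g[simplified] k scl_scl F intro!: additive_inter additive_sets)
  finally have "l * k = 1" by (simp add: scl_def hvec_def)
  then have "k = 1 \<or> k = - 1" by (metis mult.commute zmult_eq_1_iff)
  with k show ?thesis by (auto simp: scl_minus)
qed

text \<open>A divisor \<open>t\<close> of a power of two is a signed power of two. Modulo 17,
  \<open>2 ^ 8 = 256\<close> is congruent to 1 and \<open>3 ^ 8 = 6561\<close> to -1, so eighth
  powers tell the two sides apart.\<close>

lemma not_cong_17:
  fixes t s :: int
  assumes "t dvd 2 ^ N" "e = 1 \<or> e = - 1"
  shows "t * 2 ^ q - 17 * s \<noteq> e * 3 * 2 ^ l"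
proof
  assume eq: "t * 2 ^ q - 17 * s = e * 3 * 2 ^ l"
  have p2: "[(2::int) ^ (8 * i) = 1] (mod 17)" for i
  proof -
    have "[((2::int) ^ 8) ^ i = 1 ^ i] (mod 17)" by (rule cong_pow) (simp add: cong_def)
    then show ?thesis by (simp add: power_mult)
  qed
  have "nat \<bar>t\<bar> dvd 2 ^ N" using assms(1) by (simp add: nat_dvd_iff abs_dvd_iff flip: int_dvd_int_iff)
  then obtain i where "nat \<bar>t\<bar> = 2 ^ i" using divides_primepow_nat[of 2] two_is_prime_nat by blast
  then have "\<bar>t\<bar> = 2 ^ i" by (metis abs_ge_zero int_nat_eq of_nat_numeral of_nat_power)
  then have "\<bar>t\<bar> ^ 8 = 2 ^ (8 * i)" by (simp add: power_mult mult.commute flip: power_mult)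
  then have t8: "t ^ 8 = 2 ^ (8 * i)" by simp
  have e8: "e ^ 8 = 1" using assms(2) by auto
  have "[t * 2 ^ q = e * 3 * 2 ^ l] (mod 17)"
    using eq by (simp add: cong_iff_dvd_diff dvd_def) (metis add_diff_cancel_left' diff_add_cancel)
  then have "[(t * 2 ^ q) ^ 8 = (e * 3 * 2 ^ l) ^ 8] (mod 17)" by (rule cong_pow)
  then have "[2 ^ (8 * i) * 2 ^ (8 * q) = 6561 * 2 ^ (8 * l)] (mod (17::int))"
    by (simp add: power_mult_distrib t8 e8 mult.commute flip: power_mult)
  moreover have "[2 ^ (8 * i) * 2 ^ (8 * q) = 1 * 1] (mod (17::int))" by (intro cong_mult p2)
  moreover have "[6561 * 2 ^ (8 * l) = 16 * 1] (mod (17::int))"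
    by (rule cong_mult[OF _ p2]) (simp add: cong_def)
  ultimately have "[1 * 1 = 16 * 1] (mod (17::int))" by (meson cong_sym cong_trans)
  then show False by (simp add: cong_def)
qed

text \<open>On \<open>big \<inter> TG\<close> the map is governed by \<open>F (0, 1, 0)\<close> and
  by a factor \<open>u\<close> on the last axis. Surjectivity makes \<open>u\<close> a unit of the
  dyadic rationals, and \<open>not_cong_17\<close> separates the third coordinate
  \<open>u - 17 * w\<close> of \<open>F gvec\<close> from 3 and -3.\<close>

lemma iso_big:
  assumes F: "\<And>u w. u \<in> big \<inter> TG \<Longrightarrow> w \<in> big \<inter> TG \<Longrightarrow> F (u + w) = F u + F w"
    and im: "F ` (big \<inter> TG) = big \<inter> TH"
  shows "F gvec \<noteq> hvec" "F gvec \<noteq> - hvec"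
proof -
  have scl: "F (scl k u) = scl k (F u)" if "u \<in> big \<inter> TG" for k u
    using F additive_inter[OF additive_sets(1,5)] that by (rule additive_scl(2))
  have mem: "(0, v, z) \<in> big \<inter> TG" if "dyadic z" for v z using that by (simp add: big_def TG_def)
  \<comment> \<open>Each \<open>(0, 0, z)\<close> is divisible by all powers of 2 inside the domain,
    hence so is the first coordinate \<open>d\<close> of its image. Taking \<open>j\<close> as the
    absolute value of \<open>d\<close> suffices because \<open>2 ^ j > j\<close>.\<close>
  have d0: "fst (F (0, 0, z)) = 0" if "dyadic z" for z
  proof (rule ccontr)
    define d where "d = fst (F (0, 0, z))"
    assume "fst (F (0, 0, z)) \<noteq> 0"
    then have d: "d \<noteq> 0" by (simp add: d_def)
    define j where "j = nat \<bar>d\<bar>"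
    have "scl (2 ^ j) (0, 0, z / 2 ^ j) = (0, 0, z)" by (simp add: scl_def)
    then have "F (0, 0, z) = scl (2 ^ j) (F (0, 0, z / 2 ^ j))"
      using scl[OF mem[OF dyadic_div2[OF that]], of "2 ^ j" 0 j] by simp
    then have "2 ^ j dvd d" unfolding d_def by (simp add: scl_def)
    then have "2 ^ j \<le> \<bar>d\<bar>" using dvd_imp_le_int[OF d, of "2 ^ j"] by simp
    moreover have "int j < 2 ^ j" by (rule of_nat_less_two_power)
    ultimately show False by (simp add: j_def)
  qed
  obtain x1 v1 w where F1: "F (0, 1, 0) = (x1, v1, w)" by (metis prod.collapse)
  have "F (0, 1, 0) \<in> big \<inter> TH" using im mem[OF dyadic_0] by blast
  then have "dyadic w" unfolding F1 big_def by simp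
  have Feq: "F (0, v, z) = scl v (x1, v1, w) + F (0, 0, z)" if "dyadic z" for v z
  proof -
    have "scl v (0, 1, 0) \<in> big \<inter> TG" using mem[OF dyadic_0, of v] by (simp add: scl_def)
    then have "F (scl v (0, 1, 0) + (0, 0, z)) = F (scl v (0, 1, 0)) + F (0, 0, z)"
      using mem[OF that, of 0] by (rule F)
    moreover have "scl v (0, 1, 0) + (0, 0, z) = (0, v, z)" by (simp add: scl_def)
    ultimately show ?thesis using scl[OF mem[OF dyadic_0], of v 1] F1 by simp
  qed
  have surj: "\<exists>v z. dyadic z \<and> F (0, v, z) = u" if "u \<in> big \<inter> TH" for u
  proof -
    have "u \<in> F ` (big \<inter> TG)" using that by (simp only: im)
    then obtain w where w: "u = F w" "w \<in> big \<inter> TG" by (rule imageE)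
    obtain x v z where "w = (x, v, z)" by (rule prod_cases3)
    with w have "dyadic z \<and> F (0, v, z) = u" by (simp add: big_def TG_def)
    then show ?thesis by blast
  qed
  have fst_F: "fst (F (0, v, z)) = v * x1" if "dyadic z" for v z
    by (subst Feq[OF that]) (simp add: d0[OF that] scl_def)
  \<comment> \<open>First coordinates of images are \<open>v * x1\<close>. Hitting 1 forces
    \<open>x1 \<noteq> 0\<close>, and then any preimage of \<open>(0, 0, 1)\<close> has
    \<open>v = 0\<close>, so it lies on the last axis.\<close>
  have "(1, - 3, 0) \<in> big \<inter> TH" by (simp add: big_def TH_def dyadic_0)
  then obtain v z where vz: "dyadic z" "F (0, v, z) = (1, - 3, 0)" using surj[of "(1, - 3, 0)"] by metis
  then have "x1 \<noteq> 0" using fst_F[OF vz(1), of v] by auto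
  have "(0, 0, 1) \<in> big \<inter> TH" by (simp add: big_def TH_def dyadic_1)
  then obtain v z where vz: "dyadic z" "F (0, v, z) = (0, 0, 1)" using surj[of "(0, 0, 1)"] by metis
  then have "v = 0" using fst_F[OF vz(1), of v] \<open>x1 \<noteq> 0\<close> by auto
  obtain m j where z: "z = of_int m / 2 ^ j" using vz(1) unfolding dyadic_def by blast
  define u where "u = snd (snd (F (0, 0, 1)))"
  have "F (0, 0, 1) \<in> big \<inter> TH" using im mem[OF dyadic_1] by blast
  then have "dyadic u" unfolding u_def big_def by auto
  then obtain t l where t: "u = of_int t / 2 ^ l" unfolding dyadic_def by blast
  \<comment> \<open>With \<open>z = m / 2 ^ j\<close> and \<open>u = t / 2 ^ l\<close>, the relation
    \<open>u * z = 1\<close> becomes \<open>m * t = 2 ^ (j + l)\<close>, so the numerator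
    \<open>t\<close> divides a power of two.\<close>
  have "scl (2 ^ j) (0, 0, z) = scl m (0, 0, 1)" by (simp add: scl_def z)
  then have "scl (2 ^ j) (F (0, 0, z)) = scl m (F (0, 0, 1))"
    using scl[OF mem[OF vz(1)], of "2 ^ j" 0] scl[OF mem[OF dyadic_1], of m 0] by simp
  then have "2 ^ j = of_int m * u" using vz(2) unfolding \<open>v = 0\<close> by (simp add: scl_def u_def)
  then have "of_int (2 ^ (j + l)) = (of_int (m * t) :: rat)" by (simp add: t field_simps power_add)
  then have "2 ^ (j + l) = m * t" by (rule of_int_eq_iff[THEN iffD1])
  then have tdvd: "t dvd 2 ^ (j + l)" by simp
  obtain s q where w: "w = of_int s / 2 ^ q" using \<open>dyadic w\<close> unfolding dyadic_def by blast
  have third: "snd (snd (F gvec)) = u - 17 * w"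
    unfolding gvec_def by (subst Feq[OF dyadic_1]) (simp add: scl_def u_def)
  \<comment> \<open>The values \<open>e * 3\<close> are the third coordinates of
    \<open>- hvec\<close> and \<open>hvec\<close>. Multiplying by \<open>2 ^ (l + q)\<close> clears
    the denominators.\<close>
  have ne: "snd (snd (F gvec)) \<noteq> of_int (e * 3)" if e: "e = 1 \<or> e = - 1" for e
  proof
    assume "snd (snd (F gvec)) = of_int (e * 3)"
    then have "u - 17 * w = of_int (e * 3)" by (simp add: third)
    then have "of_int (t * 2 ^ q - 17 * (s * 2 ^ l)) = (of_int (e * 3 * 2 ^ (l + q)) :: rat)"
      by (simp add: t w field_simps power_add)
    then have "t * 2 ^ q - 17 * (s * 2 ^ l) = e * 3 * 2 ^ (l + q)" by (rule of_int_eq_iff[THEN iffD1])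
    with not_cong_17[OF tdvd e] show False by blast
  qed
  show "F gvec \<noteq> hvec" "F gvec \<noteq> - hvec" using ne[of "- 1"] ne[of 1] by (auto simp: hvec_def)
qed

section \<open>Groups of named vectors\<close>

text \<open>The map \<open>v\<close> embeds the names into the vectors and respects addition, so
  group laws for names can be verified on vectors.\<close>

locale vgroup =
  fixes G :: "nat monoid" (structure) and v :: "nat \<Rightarrow> vec"
  assumes inj: "inj_on v (carrier G)"
    and mult_closed: "a \<in> carrier G \<Longrightarrow> b \<in> carrier G \<Longrightarrow> a \<otimes> b \<in> carrier G"
    and v_mult: "a \<in> carrier G \<Longrightarrow> b \<in> carrier G \<Longrightarrow> v (a \<otimes> b) = v a + v b"
    and one_carrier: "\<one> \<in> carrier G"
    and v_one: "v \<one> = 0"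
    and ex_minus: "a \<in> carrier G \<Longrightarrow> \<exists>b\<in>carrier G. v b = - v a"
begin

lemma v_eqI: "a \<in> carrier G \<Longrightarrow> b \<in> carrier G \<Longrightarrow> v a = v b \<Longrightarrow> a = b"
  using inj by (blast dest: inj_onD)

lemma comm_group: "comm_group G"
proof (rule comm_groupI)
  fix a assume a: "a \<in> carrier G"
  then obtain b where b: "b \<in> carrier G" "v b = - v a" using ex_minus by blast
  then have "b \<otimes> a = \<one>" using a by (intro v_eqI) (simp_all add: mult_closed one_carrier v_mult v_one)
  with b show "\<exists>b\<in>carrier G. b \<otimes> a = \<one>" by blast
qed (auto intro!: v_eqI simp: mult_closed one_carrier v_mult v_one ac_simps)

lemma v_inv: "a \<in> carrier G \<Longrightarrow> v (inv a) = - v a"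
proof -
  interpret comm_group G by (rule comm_group)
  assume a: "a \<in> carrier G"
  then have "v (inv a) + v a = 0" by (simp flip: v_mult add: v_one)
  then show ?thesis by (simp add: eq_neg_iff_add_eq_0)
qed

lemma v_int_pow: "a \<in> carrier G \<Longrightarrow> v (a [^] (k::int)) = scl k (v a)"
proof -
  interpret comm_group G by (rule comm_group)
  assume a: "a \<in> carrier G"
  have nat: "v (a [^] n) = scl (int n) (v a)" for n :: nat
    by (induction n) (simp_all add: v_one v_mult a scl_add add.commute)
  show ?thesis
  proof (cases "k < 0")
    case True
    then have "a [^] k = inv (a [^] nat (- k))" by (subst int_pow_def2) simp
    then have "v (a [^] k) = - v (a [^] nat (- k))" using a by (simp only: v_inv nat_pow_closed)
    also have "\<dots> = scl (- int (nat (- k))) (v a)" by (simp only: nat scl_minus)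
    finally show ?thesis using True by simp
  next
    case False
    then have "a [^] k = a [^] nat k" by (subst int_pow_def2) simp
    then have "v (a [^] k) = scl (int (nat k)) (v a)" by (simp only: nat)
    with False show ?thesis by simp
  qed
qed

lemma sub_vgroup:
  assumes "additive_set T"
  shows "vgroup (G\<lparr>carrier := {n \<in> carrier G. v n \<in> T}\<rparr>) v"
proof (unfold_locales, goal_cases)
  case 1 show ?case using inj by (auto intro: inj_on_subset)
next
  case (6 a)
  then obtain b where "b \<in> carrier G" "v b = - v a" using ex_minus[of a] by auto
  then show ?case using 6 assms by (auto simp: additive_set_def)
qed (use assms in \<open>auto simp: additive_set_def mult_closed v_mult v_one one_carrier\<close>)

lemma sub_subgroup:
  assumes "additive_set T"
  shows "subgroup {n \<in> carrier G. v n \<in> T} G"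
proof -
  interpret comm_group G by (rule comm_group)
  show ?thesis
    by (rule subgroup.intro) (use assms in \<open>auto simp: additive_set_def v_mult v_one v_inv\<close>)
qed

text \<open>Names exist exactly for the vectors in \<open>S\<close>. As \<open>S\<close> is closed
  under differences, both summands \<open>t\<close> and \<open>u - t\<close> of the splitting lie in
  \<open>S\<close> and so have names.\<close>

lemma dsum:
  assumes im: "v ` carrier G = S" and S: "additive_set S" and T: "additive_set T" "additive_set T'"
    and inter: "T \<inter> T' = {0}"
    and sub: "T \<subseteq> S" and split: "\<And>u. u \<in> S \<Longrightarrow> \<exists>t\<in>T. u - t \<in> T'"
  shows "internal_dsum G {n \<in> carrier G. v n \<in> T} {n \<in> carrier G. v n \<in> T'}"
proof -
  have "n = \<one>" if "n \<in> carrier G" "v n \<in> T" "v n \<in> T'" for n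
  proof -
    have "v n \<in> T \<inter> T'" using that by simp
    then have "v n = v \<one>" by (simp add: inter v_one)
    with that(1) one_carrier show ?thesis by (rule v_eqI)
  qed
  moreover have "v \<one> \<in> T" "v \<one> \<in> T'" using T by (simp_all add: v_one additive_set_def)
  ultimately have int: "{n \<in> carrier G. v n \<in> T} \<inter> {n \<in> carrier G. v n \<in> T'} = {\<one>}"
    using one_carrier by blast
  have "n \<in> {n \<in> carrier G. v n \<in> T} <#> {n \<in> carrier G. v n \<in> T'}" if n: "n \<in> carrier G" for n
  proof -
    have "v n \<in> S" using n by (simp flip: im)
    then obtain t where t: "t \<in> T" "v n - t \<in> T'" using split by blast
    have "- t \<in> S" using t sub S unfolding additive_set_def by blast
    then have "v n + - t \<in> S" using \<open>v n \<in> S\<close> S unfolding additive_set_def by blast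
    then have "v n - t \<in> v ` carrier G" "t \<in> v ` carrier G" using t(1) sub by (auto simp only: im diff_conv_add_uminus)
    then obtain a b where ab: "a \<in> carrier G" "b \<in> carrier G" "v a = t" "v b = v n - t" by (metis imageE)
    then have "v n = v (a \<otimes> b)" by (simp add: v_mult)
    then have "n = a \<otimes> b" using v_eqI n ab(1,2) mult_closed by simp
    moreover have "a \<in> {n \<in> carrier G. v n \<in> T}" "b \<in> {n \<in> carrier G. v n \<in> T'}"
      using ab t by simp_all
    ultimately show ?thesis unfolding set_mult_def by blast
  qed
  then have "{n \<in> carrier G. v n \<in> T} <#> {n \<in> carrier G. v n \<in> T'} = carrier G"
    by (auto simp: set_mult_def mult_closed)
  with int sub_subgroup[OF T(1)] sub_subgroup[OF T(2)] show ?thesis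
    by (simp add: internal_dsum_def)
qed

lemma generate_range:
  assumes a: "a \<in> carrier G"
  shows "generate G {a} = {n \<in> carrier G. v n \<in> range (\<lambda>k. scl k (v a))}"
proof -
  interpret comm_group G by (rule comm_group)
  have "n \<in> range (\<lambda>k::int. a [^] k)" if n: "n \<in> carrier G" "v n = scl k (v a)" for n k
  proof -
    have "n = a [^] k" using n a by (intro v_eqI) (simp_all add: v_int_pow)
    then show ?thesis by blast
  qed
  then have "{n \<in> carrier G. v n \<in> range (\<lambda>k. scl k (v a))} = range (\<lambda>k::int. a [^] k)"
    using a v_int_pow by auto
  moreover have "generate G {a} = range (\<lambda>k::int. a [^] k)" using generate_pow[OF a] by auto
  ultimately show ?thesis by simp
qed

lemma cyclic_iso:
  assumes a: "a \<in> carrier G" "v a \<noteq> 0" and gen: "\<And>n. n \<in> carrier G \<Longrightarrow> \<exists>k. v n = scl k (v a)"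
  shows "integer_group \<cong> G"
proof -
  interpret comm_group G by (rule comm_group)
  have "inj (\<lambda>k::int. a [^] k)"
  proof (rule injI)
    fix k l :: int assume "a [^] k = a [^] l"
    then have "scl k (v a) = scl l (v a)" using a(1) by (metis v_int_pow)
    then have "scl (k + - l) (v a) = 0" by (simp only: scl_add scl_minus) simp
    then show "k = l" using a(2) by (simp add: scl_eq_0)
  qed
  moreover have "n \<in> range (\<lambda>k::int. a [^] k)" if n: "n \<in> carrier G" for n
  proof -
    obtain k where "v n = scl k (v a)" using gen n by blast
    then have "n = a [^] k" using n a by (intro v_eqI) (simp_all add: v_int_pow)
    then show ?thesis by blast
  qed
  then have "range (\<lambda>k::int. a [^] k) = carrier G" using a(1) by auto
  ultimately have "(\<lambda>k::int. a [^] k) \<in> iso integer_group G"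
    by (auto simp: iso_def hom_def bij_betw_def int_pow_mult a(1))
  then show ?thesis by (rule is_isoI)
qed

lemma cyclic_rank:
  assumes a: "a \<in> carrier G" "v a \<noteq> 0" and gen: "\<And>n. n \<in> carrier G \<Longrightarrow> \<exists>k. v n = scl k (v a)"
  shows "has_rank G 1"
proof -
  interpret comm_group G by (rule comm_group)
  have "lin_indep G {a}"
    unfolding lin_indep_def
  proof (intro conjI allI impI ballI)
    fix T t and c :: "nat \<Rightarrow> int"
    assume T: "T \<subseteq> {a}" "finprod G (\<lambda>t. t [^] c t) T = \<one>" "t \<in> T"
    then have "T = {a}" "t = a" by auto
    with T a have "a [^] c a = \<one>" by simp
    then have "scl (c a) (v a) = 0" using v_int_pow[OF a(1)] v_one by metis
    then show "c t = 0" using a \<open>t = a\<close> by (simp add: scl_eq_0)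
  qed (use a in auto)
  moreover have "S' = {a}" if S': "lin_indep G S' \<and> {a} \<subseteq> S'" for S'
  proof (rule ccontr)
    assume "S' \<noteq> {a}"
    then obtain t where t: "t \<in> S'" "t \<noteq> a" using S' by blast
    then have tc: "t \<in> carrier G" using S' by (auto simp: lin_indep_def)
    obtain k where k: "v t = scl k (v a)" using gen tc by blast
    \<comment> \<open>The relation saying that \<open>t\<close> is the \<open>k\<close>-th power of
      \<open>a\<close> has coefficient -1 at \<open>t\<close>, so no set properly containing
      \<open>{a}\<close> is independent.\<close>
    define c where "c = (\<lambda>s. if s = t then - 1 else k)"
    have "finprod G (\<lambda>s. s [^] c s) {a, t} = a [^] k \<otimes> t [^] (- 1 :: int)"
      using t a tc by (simp add: c_def)
    also have "\<dots> = \<one>"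
      using a tc k by (intro v_eqI) (simp_all add: v_mult v_one v_int_pow scl_minus)
    finally have "finprod G (\<lambda>s. s [^] c s) {a, t} = \<one>" .
    moreover have "{a, t} \<subseteq> S'" "finite {a, t}" using S' t by auto
    ultimately have "c t = 0" using S' unfolding lin_indep_def by blast
    then show False by (simp add: c_def)
  qed
  ultimately show ?thesis unfolding has_rank_def
    by (intro exI[of _ "{a}"] conjI allI impI) (blast, blast, simp_all)
qed

end

section \<open>The computable groups\<close>

text \<open>Seven natural numbers code a vector: a difference of naturals for each integer, and a
  difference over \<open>2 ^ j\<close> for the dyadic coordinate. Every number is a code, and every
  vector of \<open>big\<close> has many.\<close>

definition fx :: "nat \<Rightarrow> nat" where "fx w = p1 (p1 w)"
definition fx' :: "nat \<Rightarrow> nat" where "fx' w = p2 (p1 w)"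
definition fv :: "nat \<Rightarrow> nat" where "fv w = p1 (p1 (p2 w))"
definition fv' :: "nat \<Rightarrow> nat" where "fv' w = p2 (p1 (p2 w))"
definition fz :: "nat \<Rightarrow> nat" where "fz w = p1 (p1 (p2 (p2 w)))"
definition fz' :: "nat \<Rightarrow> nat" where "fz' w = p2 (p1 (p2 (p2 w)))"
definition fj :: "nat \<Rightarrow> nat" where "fj w = p2 (p2 (p2 w))"

lemmas field_defs = fx_def fx'_def fv_def fv'_def fz_def fz'_def fj_def

definition val :: "nat \<Rightarrow> vec" where
  "val w = (int (fx w) - int (fx' w), int (fv w) - int (fv' w),
            (rat_of_nat (fz w) - rat_of_nat (fz' w)) / 2 ^ fj w)"

lemma val_in_big: "val w \<in> big"
proof -
  have "(rat_of_nat (fz w) - rat_of_nat (fz' w)) / 2 ^ fj w = of_int (int (fz w) - int (fz' w)) / 2 ^ fj w"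
    by simp
  then have "dyadic ((rat_of_nat (fz w) - rat_of_nat (fz' w)) / 2 ^ fj w)"
    unfolding dyadic_def by blast
  then show ?thesis by (simp add: big_def val_def)
qed

lemma val_surj: "u \<in> big \<Longrightarrow> \<exists>w. val w = u"
proof -
  assume "u \<in> big"
  then obtain x v m j where u: "u = (x, v, of_int m / 2 ^ j)" unfolding big_def dyadic_def by auto
  have eq: "int (nat k) - int (nat (- k)) = k" for k by simp
  have "rat_of_nat (nat m) - rat_of_nat (nat (- m)) = rat_of_int m"
    by (cases "m \<ge> 0") simp_all
  then have "val (pr (pr (nat x) (nat (- x))) (pr (pr (nat v) (nat (- v))) (pr (pr (nat m) (nat (- m))) j))) = u"
    by (simp add: val_def field_defs u eq)
  then show ?thesis by blast
qed

lemma val_0: "val 0 = 0"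
proof -
  have "prod_encode (0, 0) = 0" by (simp add: prod_encode_def)
  then have "prod_decode 0 = (0, 0)" by (metis prod_encode_inverse)
  then show ?thesis by (simp add: val_def field_defs zero_prod_def)
qed

lemma rc_fields:
  "rcomp Os f \<Longrightarrow> rcomp Os (\<lambda>x. fx (f x))" "rcomp Os f \<Longrightarrow> rcomp Os (\<lambda>x. fx' (f x))"
  "rcomp Os f \<Longrightarrow> rcomp Os (\<lambda>x. fv (f x))" "rcomp Os f \<Longrightarrow> rcomp Os (\<lambda>x. fv' (f x))"
  "rcomp Os f \<Longrightarrow> rcomp Os (\<lambda>x. fz (f x))" "rcomp Os f \<Longrightarrow> rcomp Os (\<lambda>x. fz' (f x))"
  "rcomp Os f \<Longrightarrow> rcomp Os (\<lambda>x. fj (f x))"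
  unfolding field_defs by (intro rc; assumption)+

text \<open>Clearing denominators and moving negative terms across gives an equation between natural
  numbers, to which the closure rules apply.\<close>

lemma frac_sum_iff:
  fixes a b c d e f :: nat
  shows "(rat_of_nat a - rat_of_nat b) / 2 ^ i
      = (rat_of_nat c - rat_of_nat d) / 2 ^ j + (rat_of_nat e - rat_of_nat f) / 2 ^ k \<longleftrightarrow>
    a * 2 ^ j * 2 ^ k + d * 2 ^ i * 2 ^ k + f * 2 ^ i * 2 ^ j
      = b * 2 ^ j * 2 ^ k + c * 2 ^ i * 2 ^ k + e * 2 ^ i * 2 ^ j" (is "?l \<longleftrightarrow> ?m = ?n")
proof -
  have "?m = ?n \<longleftrightarrow> rat_of_nat ?m = rat_of_nat ?n" by (simp only: of_nat_eq_iff)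
  also have "\<dots> \<longleftrightarrow> ?l" by (simp add: field_simps)
  finally show ?thesis by simp
qed

lemma rdec_val_sum:
  "rcomp Os f \<Longrightarrow> rcomp Os g \<Longrightarrow> rcomp Os h \<Longrightarrow> rdec Os (\<lambda>x. val (f x) = val (g x) + val (h x))"
proof -
  assume *: "rcomp Os f" "rcomp Os g" "rcomp Os h"
  have eq: "val w = val s + val t \<longleftrightarrow>
      fx w + fx' s + fx' t = fx' w + fx s + fx t \<and> fv w + fv' s + fv' t = fv' w + fv s + fv t \<and>
      fz w * 2 ^ fj s * 2 ^ fj t + fz' s * 2 ^ fj w * 2 ^ fj t + fz' t * 2 ^ fj w * 2 ^ fj s
      = fz' w * 2 ^ fj s * 2 ^ fj t + fz s * 2 ^ fj w * 2 ^ fj t + fz t * 2 ^ fj w * 2 ^ fj s" for w s t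
    unfolding val_def plus_prod_def by (simp add: frac_sum_iff) linarith
  show ?thesis unfolding eq by (intro * rc rc_fields)
qed

lemma rdec_val_eq: "rcomp Os f \<Longrightarrow> rcomp Os g \<Longrightarrow> rdec Os (\<lambda>x. val (f x) = val (g x))"
  using rdec_val_sum[of Os f g "\<lambda>_. 0"] by (simp add: val_0 rcomp_const)

lemma frac_lin_iff:
  fixes a b c d e :: nat
  shows "rat_of_int (int a - int b) = of_nat e * ((rat_of_nat c - rat_of_nat d) / 2 ^ i) \<longleftrightarrow>
     a * 2 ^ i + e * d = b * 2 ^ i + e * c" (is "?l \<longleftrightarrow> ?m = ?n")
proof -
  have "?m = ?n \<longleftrightarrow> rat_of_nat ?m = rat_of_nat ?n" by (simp only: of_nat_eq_iff)
  also have "\<dots> \<longleftrightarrow> ?l" by (simp add: field_simps)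
  finally show ?thesis by simp
qed

lemma val_sets:
  "val w \<in> small \<longleftrightarrow> fv' w * 2 ^ fj w + 17 * fz' w = fv w * 2 ^ fj w + 17 * fz w"
  "val w \<in> TA \<longleftrightarrow> fv w = fv' w \<and> fz w = fz' w"
  "val w \<in> TB \<longleftrightarrow> val w \<in> small \<and> fx w * 2 ^ fj w + 6 * fz' w = fx' w * 2 ^ fj w + 6 * fz w"
  "val w \<in> TG \<longleftrightarrow> fx w = fx' w"
  "val w \<in> TH \<longleftrightarrow> fv w + 3 * fx w = fv' w + 3 * fx' w"
proof -
  have d: "dyadic ((rat_of_nat (fz w) - rat_of_nat (fz' w)) / 2 ^ fj w)"
    using val_in_big[of w] by (simp add: big_def val_def)
  have m: "rat_of_int (int a - int b) = - 17 * r \<longleftrightarrow> rat_of_int (int b - int a) = rat_of_nat 17 * r" for a b r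
    by auto
  show s: "val w \<in> small \<longleftrightarrow> fv' w * 2 ^ fj w + 17 * fz' w = fv w * 2 ^ fj w + 17 * fz w"
    using d by (simp only: small_def val_def mem_Collect_eq prod.case m frac_lin_iff simp_thms)
  show "val w \<in> TB \<longleftrightarrow> val w \<in> small \<and> fx w * 2 ^ fj w + 6 * fz' w = fx' w * 2 ^ fj w + 6 * fz w"
    using d frac_lin_iff[of "fx w" "fx' w" 6 "fz w" "fz' w" "fj w"]
    by (simp add: TB_def small_def val_def)
  show "val w \<in> TA \<longleftrightarrow> fv w = fv' w \<and> fz w = fz' w"
    "val w \<in> TG \<longleftrightarrow> fx w = fx' w"
    "val w \<in> TH \<longleftrightarrow> fv w + 3 * fx w = fv' w + 3 * fx' w"
    by (auto simp: TA_def TG_def TH_def val_def)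
qed

lemma rdec_val_sets:
  assumes "rcomp Os f"
  shows "rdec Os (\<lambda>x. val (f x) \<in> small)" "rdec Os (\<lambda>x. val (f x) \<in> TA)" "rdec Os (\<lambda>x. val (f x) \<in> TB)"
    "rdec Os (\<lambda>x. val (f x) \<in> TG)" "rdec Os (\<lambda>x. val (f x) \<in> TH)"
  unfolding val_sets by (intro assms rc rc_fields)+

text \<open>The tag 0 makes this a name only for vectors in \<open>small\<close>. All distinguished
  vectors lie there, so their names are constants independent of \<open>x\<close>.\<close>

definition nm :: "vec \<Rightarrow> nat" where "nm u = pr 0 (LEAST w. val w = u)"

definition vv :: "nat \<Rightarrow> vec" where "vv n = val (p2 n)"

definition least_halt :: "nat \<Rightarrow> nat \<Rightarrow> bool" where
  "least_halt x s \<longleftrightarrow> halts_in x s \<and> (\<forall>i<s. \<not> halts_in x i)"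

text \<open>A name of a vector is a pair of a tag and the least code of the vector. The tag is \<open>0\<close> for
  vectors in \<open>small\<close>; for the others it is the successor of the halting time, which makes
  the domain decidable although it depends on whether \<open>x\<close> halts.\<close>

definition edom :: "nat \<Rightarrow> nat \<Rightarrow> bool" where
  "edom x n \<longleftrightarrow> (\<forall>m<p2 n. val m \<noteq> val (p2 n)) \<and>
     (p1 n = 0 \<and> vv n \<in> small \<or> p1 n \<noteq> 0 \<and> vv n \<notin> small \<and> least_halt x (p1 n - Suc 0))"

text \<open>If the sum lies outside \<open>small\<close>, so does a summand, whose nonzero tag
  already records the halting time. The operation never has to search for that time.\<close>

definition eop :: "nat \<Rightarrow> nat \<Rightarrow> nat" where
  "eop m n = (let w = LEAST c. val c = val (p2 m) + val (p2 n) in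
     pr (if val w \<in> small then 0 else if p1 m = 0 then p1 n else p1 m) w)"

definition ambient :: "nat \<Rightarrow> vec set" where
  "ambient x = (if x \<in> halting_set then big else small)"

lemma ambient_additive: "additive_set (ambient x)"
  by (simp add: ambient_def additive_sets)

lemma small_subset_ambient: "small \<subseteq> ambient x"
  using small_subset_big by (simp add: ambient_def)

lemma edom_inj: "inj_on vv {n. edom x n}"
proof (rule inj_onI)
  fix m n assume "m \<in> {n. edom x n}" "n \<in> {n. edom x n}" and v: "vv m = vv n"
  then have m: "edom x m" and n: "edom x n" by auto
  have "\<not> p2 m < p2 n" "\<not> p2 n < p2 m"
    using m n v by (auto simp: edom_def vv_def)
  then have p2: "p2 m = p2 n" by simp
  have least: "s = t" if "least_halt x s" "least_halt x t" for s t
  proof -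
    have "\<not> s < t" "\<not> t < s" using that by (auto simp: least_halt_def)
    then show ?thesis by simp
  qed
  have "p1 m = p1 n"
  proof (cases "vv m \<in> small")
    case True
    then show ?thesis using m n v by (simp add: edom_def)
  next
    case False
    then have "p1 m \<noteq> 0" "p1 n \<noteq> 0" "p1 m - Suc 0 = p1 n - Suc 0"
      using m n v least[of "p1 m - Suc 0" "p1 n - Suc 0"] by (simp_all add: edom_def)
    then show ?thesis by simp
  qed
  with p2 have "prod_decode m = prod_decode n" by (simp add: prod_eq_iff)
  then show "m = n" by (metis prod_decode_inverse)
qed

lemma least_val:
  assumes "u \<in> big" "w = (LEAST w. val w = u)"
  shows "val w = u" "\<forall>m<w. val m \<noteq> u"
  unfolding assms(2) using LeastI_ex[OF val_surj[OF assms(1)]] not_less_Least by blast+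

lemma edom_nm:
  assumes "u \<in> small"
  shows "edom x (nm u)" "vv (nm u) = u"
proof -
  define w where "w = (LEAST w. val w = u)"
  have "u \<in> big" using assms small_subset_big by blast
  note w = least_val[OF this w_def]
  have "nm u = pr 0 w" by (simp add: nm_def w_def)
  then show "edom x (nm u)" "vv (nm u) = u" using assms w by (simp_all add: edom_def vv_def)
qed

lemma edom_halting: "edom x n \<Longrightarrow> vv n \<notin> small \<Longrightarrow> x \<in> halting_set"
  unfolding edom_def least_halt_def halting_set_iff by blast

text \<open>Vectors outside \<open>small\<close> receive names exactly when a halting time is
  available to serve as tag.\<close>

lemma edom_image: "vv ` {n. edom x n} = ambient x"
proof
  show "vv ` {n. edom x n} \<subseteq> ambient x"
  proof
    fix u assume "u \<in> vv ` {n. edom x n}"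
    then obtain n where n: "edom x n" "u = vv n" by auto
    show "u \<in> ambient x"
    proof (cases "u \<in> small")
      case True then show ?thesis using small_subset_ambient by blast
    next
      case False
      then have "x \<in> halting_set" using edom_halting n by simp
      then show ?thesis using val_in_big by (simp add: ambient_def n vv_def)
    qed
  qed
  show "ambient x \<subseteq> vv ` {n. edom x n}"
  proof
    fix u assume u: "u \<in> ambient x"
    show "u \<in> vv ` {n. edom x n}"
    proof (cases "u \<in> small")
      case True
      have "vv (nm u) \<in> vv ` {n. edom x n}" using edom_nm(1)[OF True] by (intro imageI) simp
      then show ?thesis by (simp only: edom_nm(2)[OF True])
    next
      case False
      then have x: "x \<in> halting_set" and ub: "u \<in> big"
        using u by (auto simp: ambient_def split: if_splits)
      then obtain s where hs: "halts_in x s" using halting_set_iff by blast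
      then have s: "least_halt x (LEAST s. halts_in x s)"
        unfolding least_halt_def using LeastI[of "halts_in x", OF hs] not_less_Least by blast
      define w where "w = (LEAST w. val w = u)"
      define n where "n = pr (Suc (LEAST s. halts_in x s)) w"
      note w = least_val[OF ub w_def]
      have "vv n = u" "edom x n" using False w s by (simp_all add: n_def vv_def edom_def)
      then show ?thesis by (metis imageI mem_Collect_eq)
    qed
  qed
qed

lemma edom_eop:
  assumes "edom x m" "edom x n"
  shows "edom x (eop m n)" "vv (eop m n) = vv m + vv n"
proof -
  define u where "u = vv m + vv n"
  define w where "w = (LEAST c. val c = u)"
  have "u \<in> big" unfolding u_def vv_def using val_in_big additive_sets(1) by (simp add: additive_set_def)
  note w = least_val[OF this w_def]
  have op: "eop m n = pr (if u \<in> small then 0 else if p1 m = 0 then p1 n else p1 m) w"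
    unfolding eop_def Let_def w_def[unfolded u_def vv_def, symmetric] w(1) ..
  show v: "vv (eop m n) = vv m + vv n" by (simp add: op vv_def[of "pr _ _"] w(1)) (simp add: u_def)
  have "vv m \<notin> small \<or> vv n \<notin> small" if "u \<notin> small"
    using that additive_sets(2) unfolding u_def additive_set_def by blast
  then show "edom x (eop m n)"
    using assms w by (auto simp: edom_def op vv_def[of "pr _ _"])
qed

section \<open>Computability of the group and its subgroups, uniformly in \<open>x\<close>\<close>

lemma rdec_least_halt: "rcomp Os f \<Longrightarrow> rcomp Os g \<Longrightarrow> rdec Os (\<lambda>x. least_halt (f x) (g x))"
proof -
  assume f: "rcomp Os f" and g: "rcomp Os g"
  show ?thesis unfolding least_halt_def
    by (intro rdec_all_less rdec_halts_in rc f g rcomp_comp[OF f])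
qed

lemma rdec_edom: "rcomp Os f \<Longrightarrow> rcomp Os g \<Longrightarrow> rdec Os (\<lambda>x. edom (f x) (g x))"
proof -
  assume f: "rcomp Os f" and g: "rcomp Os g"
  show ?thesis unfolding edom_def vv_def
    by (intro rdec_all_less rdec_least_halt rdec_val_eq rdec_val_sets rc f g rcomp_comp[OF g])
qed

lemma rcomp_eop: "rcomp Os f \<Longrightarrow> rcomp Os g \<Longrightarrow> rcomp Os (\<lambda>x. eop (f x) (g x))"
proof -
  assume f: "rcomp Os f" and g: "rcomp Os g"
  have ex: "\<exists>c. val c = val m + val n" for m n
    using val_surj val_in_big additive_sets(1) by (simp add: additive_set_def)
  have "rcomp Os (\<lambda>x. LEAST c. val c = val (p2 (f x)) + val (p2 (g x)))"
    by (intro rcomp_Least rdec_val_sum rc rcomp_comp[OF f] rcomp_comp[OF g] ex)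
  then show ?thesis unfolding eop_def Let_def
    by (intro rdec_val_sets rc f g)
qed

text \<open>The input pairs \<open>x\<close> with a group query; first component 0 asks for
  membership, anything else for the operation, in agreement with \<open>gdom\<close> and
  \<open>gop\<close>. Keeping \<open>x\<close> as an input lets \<open>smn\<close> compute the index
  of each group.\<close>

definition eprog :: "rf" where
  "eprog = (SOME P. \<forall>orc\<in>UNIV. \<forall>t. eval orc P t
     (if p1 (p2 t) = 0 then (if edom (p1 t) (p2 (p2 t)) then 1 else 0)
      else eop (p1 (p2 (p2 t))) (p2 (p2 (p2 t)))))"

definition sprog :: "vec set \<Rightarrow> rf" where
  "sprog T = (SOME P. \<forall>orc\<in>UNIV. \<forall>t. eval orc P t (if edom (p1 t) (p2 t) \<and> vv (p2 t) \<in> T then 1 else 0))"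

definition egrp :: "nat \<Rightarrow> nat" where "egrp = smn eprog"
definition eset :: "vec set \<Rightarrow> nat \<Rightarrow> nat" where "eset T = smn (sprog T)"

lemma phi_egrp:
  "phi (egrp x) m = Some (if p1 m = 0 then (if edom x (p2 m) then 1 else 0) else eop (p1 (p2 m)) (p2 (p2 m)))"
proof -
  have "rcomp UNIV (\<lambda>t. if p1 (p2 t) = 0 then (if edom (p1 t) (p2 (p2 t)) then 1 else 0)
      else eop (p1 (p2 (p2 t))) (p2 (p2 (p2 t))))"
    by (intro rc rdec_edom rcomp_eop)
  then have "\<forall>orc\<in>UNIV. \<forall>t. eval orc eprog t
     (if p1 (p2 t) = 0 then (if edom (p1 t) (p2 (p2 t)) then 1 else 0)
      else eop (p1 (p2 (p2 t))) (p2 (p2 (p2 t))))"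
    unfolding rcomp_def eprog_def by (rule someI_ex)
  from phi_smn[OF this, of x m] show ?thesis by (simp add: egrp_def)
qed

lemma phi_eset:
  assumes "rdec UNIV (\<lambda>n. vv n \<in> T)"
  shows "phi (eset T x) n = Some (if edom x n \<and> vv n \<in> T then 1 else 0)"
proof -
  have "rdec UNIV (\<lambda>t. edom (p1 t) (p2 t) \<and> vv (p2 t) \<in> T)"
    by (intro rc rdec_edom rdec_comp[OF assms])
  then have "\<forall>orc\<in>UNIV. \<forall>t. eval orc (sprog T) t (if edom (p1 t) (p2 t) \<and> vv (p2 t) \<in> T then 1 else 0)"
    unfolding rdec_def rcomp_def sprog_def by (rule someI_ex)
  from phi_smn[OF this, of x n] show ?thesis by (simp add: eset_def)
qed

lemma eset_char:
  assumes "rdec UNIV (\<lambda>n. vv n \<in> T)"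
  shows "is_char_index (eset T x)" "Cset (eset T x) = {n. edom x n \<and> vv n \<in> T}"
  by (auto simp: is_char_index_def Cset_def phi_eset[OF assms])

lemma gdom_egrp: "gdom (egrp x) = {n. edom x n}"
  by (auto simp: gdom_def phi_egrp)

lemma gop_egrp: "gop (egrp x) m n = eop m n"
  by (simp add: gop_def phi_egrp)

lemma grp_egrp: "grp (egrp x) = \<lparr>carrier = {n. edom x n}, monoid.mult = eop, one = nm 0\<rparr>"
proof -
  have z: "edom x (nm 0)" "vv (nm 0) = 0"
    using edom_nm(1)[of 0 x] edom_nm(2)[of 0] additive_sets(2) by (auto simp: additive_set_def)
  \<comment> \<open>\<open>grp\<close> obtains its unit by description: a neutral element has value
    0, and 0 has only one name.\<close>
  have "(THE u. edom x u \<and> (\<forall>n\<in>{n. edom x n}. eop u n = n \<and> eop n u = n)) = nm 0"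
  proof (rule the_equality)
    have "eop (nm 0) n = n \<and> eop n (nm 0) = n" if "edom x n" for n
      using inj_onD[OF edom_inj[of x]] edom_eop[OF z(1) that] edom_eop[OF that z(1)] that z(2) by simp
    then show "edom x (nm 0) \<and> (\<forall>n\<in>{n. edom x n}. eop (nm 0) n = n \<and> eop n (nm 0) = n)"
      using z by blast
    fix u assume u: "edom x u \<and> (\<forall>n\<in>{n. edom x n}. eop u n = n \<and> eop n u = n)"
    then have "vv u + vv (nm 0) = vv (nm 0)" using edom_eop(2) z(1) by (metis mem_Collect_eq)
    then have "vv u = vv (nm 0)" using z(2) by simp
    then show "u = nm 0" using inj_onD[OF edom_inj[of x]] u z(1) by blast
  qed
  moreover have "gop (egrp x) = eop" using gop_egrp by blast
  ultimately show ?thesis unfolding grp_def by (simp add: gdom_egrp)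
qed

lemma vgroup_egrp: "vgroup (grp (egrp x)) vv"
proof
  show "inj_on vv (carrier (grp (egrp x)))" by (simp add: grp_egrp edom_inj)
  show "\<one>\<^bsub>grp (egrp x)\<^esub> \<in> carrier (grp (egrp x))" "vv \<one>\<^bsub>grp (egrp x)\<^esub> = 0"
    using edom_nm(1)[of 0 x] edom_nm(2)[of 0] additive_sets(2) by (auto simp: additive_set_def grp_egrp)
  fix a assume a: "a \<in> carrier (grp (egrp x))"
  then have "vv a \<in> ambient x" unfolding edom_image[symmetric] by (simp add: grp_egrp)
  then have "- vv a \<in> vv ` {n. edom x n}"
    using ambient_additive[of x] unfolding edom_image by (simp add: additive_set_def)
  then show "\<exists>b\<in>carrier (grp (egrp x)). vv b = - vv a" by (auto simp: grp_egrp)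
  fix b assume b: "b \<in> carrier (grp (egrp x))"
  show "a \<otimes>\<^bsub>grp (egrp x)\<^esub> b \<in> carrier (grp (egrp x))" "vv (a \<otimes>\<^bsub>grp (egrp x)\<^esub> b) = vv a + vv b"
    using edom_eop[of x a b] a b by (simp_all add: grp_egrp)
qed

lemma computable_egrp: "computable_group (egrp x)"
  unfolding computable_group_def using vgroup.comm_group[OF vgroup_egrp[of x]]
  by (simp add: phi_egrp)

section \<open>Validity of the instances put to \<open>F\<close>\<close>

lemma rdec_vv_sets:
  "rdec UNIV (\<lambda>n. vv n \<in> TA)" "rdec UNIV (\<lambda>n. vv n \<in> TB)"
  "rdec UNIV (\<lambda>n. vv n \<in> TG)" "rdec UNIV (\<lambda>n. vv n \<in> TH)"
  unfolding vv_def by (intro rdec_val_sets rc)+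

lemma Cset_eset:
  "rdec UNIV (\<lambda>n. vv n \<in> T) \<Longrightarrow> Cset (eset T x) = {n \<in> carrier (grp (egrp x)). vv n \<in> T}"
  by (simp add: eset_char grp_egrp)

text \<open>Serves \<open>TA\<close> with \<open>avec\<close> and \<open>TB\<close> with
  \<open>bvec\<close>. Both lie in \<open>small\<close>, so these infinite cyclic groups are present
  whether or not \<open>x\<close> halts.\<close>

lemma cyclic_subgroup:
  assumes T: "T = range (\<lambda>k. scl k u)" "additive_set T" "T \<subseteq> small" "u \<noteq> 0"
    and C: "C = {n \<in> carrier (grp (egrp x)). vv n \<in> T}"
  shows "nm u \<in> C" "generate (grp (egrp x)) {nm u} = C"
    "has_rank ((grp (egrp x))\<lparr>carrier := C\<rparr>) 1"
    "integer_group \<cong> (grp (egrp x))\<lparr>carrier := C\<rparr>"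
proof -
  interpret vgroup "grp (egrp x)" vv by (rule vgroup_egrp)
  have "scl 1 u \<in> T" unfolding T(1) by (rule rangeI)
  then have u: "u \<in> T" by simp
  then have "u \<in> small" using T(3) by blast
  note nmu = edom_nm(1)[OF this, of x] edom_nm(2)[OF this]
  then have nmE: "nm u \<in> carrier (grp (egrp x))" by (simp add: grp_egrp)
  show nmC: "nm u \<in> C" using nmE nmu u by (simp add: C)
  show "generate (grp (egrp x)) {nm u} = C"
    unfolding generate_range[OF nmE] nmu C T(1) ..
  have sub: "vgroup ((grp (egrp x))\<lparr>carrier := C\<rparr>) vv"
    unfolding C by (rule sub_vgroup[OF T(2)])
  have gen: "\<exists>k. vv n = scl k (vv (nm u))" if "n \<in> carrier ((grp (egrp x))\<lparr>carrier := C\<rparr>)" for n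
    using that by (auto simp: C nmu T(1))
  show "has_rank ((grp (egrp x))\<lparr>carrier := C\<rparr>) 1"
    using nmC T(4) nmu gen by (intro vgroup.cyclic_rank[OF sub, of "nm u"]) simp_all
  show "integer_group \<cong> (grp (egrp x))\<lparr>carrier := C\<rparr>"
    using nmC T(4) nmu gen by (intro vgroup.cyclic_iso[OF sub, of "nm u"]) simp_all
qed

lemma avec_bvec_nonzero: "avec \<noteq> 0" "bvec \<noteq> 0"
  by (simp_all add: avec_def bvec_def zero_prod_def)

lemma gvec_in: "gvec \<in> small" "gvec \<in> TG"
proof -
  have "scl 1 gvec \<in> small \<inter> TG" unfolding small_TG by (rule rangeI)
  then show "gvec \<in> small" "gvec \<in> TG" by simp_all
qed

lemma hvec_in: "hvec \<in> small" "- hvec \<in> small"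
proof -
  have "scl 1 hvec \<in> small \<inter> TH" "scl (- 1) hvec \<in> small \<inter> TH" unfolding small_TH by (rule rangeI)+
  then show "hvec \<in> small" "- hvec \<in> small" by (simp_all add: scl_minus)
qed

text \<open>Nothing here depends on whether \<open>x\<close> halts: \<open>TA\<close> and
  \<open>TB\<close> lie in either ambient group, and the splittings subtract integer multiples of
  \<open>avec\<close> and \<open>bvec\<close>.\<close>

lemma instance_valid:
  "computable_group (egrp x) \<and>
   is_char_index (eset TA x) \<and> is_char_index (eset TB x) \<and>
   is_char_index (eset TG x) \<and> is_char_index (eset TH x) \<and>
   internal_dsum (grp (egrp x)) (Cset (eset TA x)) (Cset (eset TG x)) \<and>
   internal_dsum (grp (egrp x)) (Cset (eset TB x)) (Cset (eset TH x)) \<and>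
   (grp (egrp x))\<lparr>carrier := Cset (eset TA x)\<rparr> \<cong> (grp (egrp x))\<lparr>carrier := Cset (eset TB x)\<rparr> \<and>
   has_rank ((grp (egrp x))\<lparr>carrier := Cset (eset TA x)\<rparr>) 1 \<and>
   length [nm avec] = length [nm bvec] \<and>
   set [nm avec] \<subseteq> Cset (eset TA x) \<and> generate (grp (egrp x)) (set [nm avec]) = Cset (eset TA x) \<and>
   set [nm bvec] \<subseteq> Cset (eset TB x) \<and> generate (grp (egrp x)) (set [nm bvec]) = Cset (eset TB x)"
proof -
  interpret vgroup "grp (egrp x)" vv by (rule vgroup_egrp)
  have im: "vv ` carrier (grp (egrp x)) = ambient x" by (simp add: grp_egrp edom_image)
  note C = Cset_eset[OF rdec_vv_sets(1), of x] Cset_eset[OF rdec_vv_sets(2), of x]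
    Cset_eset[OF rdec_vv_sets(3), of x] Cset_eset[OF rdec_vv_sets(4), of x]
  have "internal_dsum (grp (egrp x)) (Cset (eset TA x)) (Cset (eset TG x))"
    unfolding C
  proof (rule dsum[OF im ambient_additive additive_sets(3,5) TA_TG])
    show "TA \<subseteq> ambient x" using TA_small small_subset_ambient by (rule subset_trans)
    show "\<exists>t\<in>TA. u - t \<in> TG" for u
      unfolding TA_eq using split_A by blast
  qed
  moreover have "internal_dsum (grp (egrp x)) (Cset (eset TB x)) (Cset (eset TH x))"
    unfolding C
  proof (rule dsum[OF im ambient_additive additive_sets(4,6) TB_TH])
    show "TB \<subseteq> ambient x" using TB_small small_subset_ambient by (rule subset_trans)
    show "\<exists>t\<in>TB. u - t \<in> TH" for u
      unfolding TB_eq using split_B by blast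
  qed
  moreover note A = cyclic_subgroup[OF TA_eq additive_sets(3) TA_small avec_bvec_nonzero(1) C(1)]
    and B = cyclic_subgroup[OF TB_eq additive_sets(4) TB_small avec_bvec_nonzero(2) C(2)]
  moreover have "(grp (egrp x))\<lparr>carrier := Cset (eset TA x)\<rparr> \<cong> (grp (egrp x))\<lparr>carrier := Cset (eset TB x)\<rparr>"
    using group.iso_sym[OF group_integer_group A(4)] B(4) by (rule iso_trans)
  moreover note computable_egrp[of x] eset_char(1)[OF rdec_vv_sets(1), of x]
    eset_char(1)[OF rdec_vv_sets(2), of x] eset_char(1)[OF rdec_vv_sets(3), of x]
    eset_char(1)[OF rdec_vv_sets(4), of x]
  ultimately show ?thesis by (intro conjI) simp_all
qed

text \<open>The isomorphism, read on vectors, is an additive map from \<open>ambient x \<inter> TG\<close> onto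
  \<open>ambient x \<inter> TH\<close>, so its value at the name of \<open>gvec\<close> reveals which group was built.\<close>

lemma halting_iff_value:
  assumes "phi_iso k ((grp (egrp x))\<lparr>carrier := Cset (eset TG x)\<rparr>)
    ((grp (egrp x))\<lparr>carrier := Cset (eset TH x)\<rparr>)"
  shows "phi k (nm gvec) \<noteq> None"
    "x \<in> halting_set \<longleftrightarrow> \<not> (the (phi k (nm gvec)) = nm hvec \<or> the (phi k (nm gvec)) = nm (- hvec))"
proof -
  define f where "f n = the (phi k n)" for n
  define D where "D T = {n. edom x n \<and> vv n \<in> T}" for T
  have CG: "Cset (eset TG x) = D TG" and CH: "Cset (eset TH x) = D TH"
    by (simp_all add: eset_char rdec_vv_sets D_def)
  have def: "\<forall>n\<in>D TG. phi k n \<noteq> None"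
    and iso: "f \<in> iso ((grp (egrp x))\<lparr>carrier := D TG\<rparr>) ((grp (egrp x))\<lparr>carrier := D TH\<rparr>)"
    using assms unfolding phi_iso_def CG CH f_def by simp_all
  have fim: "f ` D TG = D TH" using iso by (simp add: iso_def bij_betw_def)
  have fmult: "f (eop m n) = eop (f m) (f n)" if "m \<in> D TG" "n \<in> D TG" for m n
    using iso that by (auto simp: iso_def hom_def grp_egrp)
  have vim: "vv ` D T = ambient x \<inter> T" for T
    unfolding edom_image[symmetric] D_def by auto
  \<comment> \<open>\<open>g\<close> assigns names to the vectors of the ambient group;
    \<open>h\<close> below is \<open>f\<close> transported to vectors, to which
    \<open>iso_big\<close> or \<open>iso_small\<close> applies.\<close>
  define g where "g = inv_into {n. edom x n} vv"
  have g: "edom x (g u)" "vv (g u) = u" if "u \<in> ambient x" for u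
  proof -
    have "u \<in> vv ` {n. edom x n}" using that by (simp add: edom_image)
    then have "g u \<in> {n. edom x n}" "vv (g u) = u" unfolding g_def by (rule inv_into_into, rule f_inv_into_f)
    then show "edom x (g u)" "vv (g u) = u" by simp_all
  qed
  have gv: "g (vv n) = n" if "edom x n" for n
    unfolding g_def using that by (intro inv_into_f_f edom_inj) simp
  define h where "h u = vv (f (g u))" for u
  have gD: "g u \<in> D TG" if "u \<in> ambient x \<inter> TG" for u using g that by (simp add: D_def)
  have fD: "edom x (f n)" if "n \<in> D TG" for n using fim that by (auto simp: D_def)
  have add: "h (u + w) = h u + h w" if u: "u \<in> ambient x \<inter> TG" and w: "w \<in> ambient x \<inter> TG" for u w
  proof -
    have gu: "edom x (g u)" "vv (g u) = u" and gw: "edom x (g w)" "vv (g w) = w" using g u w by simp_all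
    have "g (u + w) = eop (g u) (g w)"
      using gv[OF edom_eop(1)[OF gu(1) gw(1)]] edom_eop(2)[OF gu(1) gw(1)] gu(2) gw(2) by simp
    then show ?thesis
      using fmult[OF gD[OF u] gD[OF w]] edom_eop(2)[OF fD[OF gD[OF u]] fD[OF gD[OF w]]]
      by (simp add: h_def)
  qed
  have "g ` (ambient x \<inter> TG) = D TG"
    unfolding vim[symmetric] image_image by (auto simp: D_def gv)
  then have him: "h ` (ambient x \<inter> TG) = ambient x \<inter> TH"
    unfolding h_def by (metis fim image_image vim)
  have nmg: "nm gvec = g gvec" "nm gvec \<in> D TG"
    using gv[OF edom_nm(1)[OF gvec_in(1)]] edom_nm(1)[OF gvec_in(1), of x] edom_nm(2)[OF gvec_in(1)] gvec_in(2)
    by (simp_all add: D_def)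
  show "phi k (nm gvec) \<noteq> None" using def nmg(2) by blast
  have y: "edom x (f (nm gvec))" "vv (f (nm gvec)) = h gvec"
    using fD[OF nmg(2)] by (simp_all add: h_def nmg(1))
  \<comment> \<open>Names are unique, so comparing numbers compares vectors. The test vectors
    \<open>hvec\<close> and \<open>- hvec\<close> have names in either case.\<close>
  have val_iff: "f (nm gvec) = nm u \<longleftrightarrow> h gvec = u" if "u \<in> small" for u
    using y edom_nm(1)[OF that, of x] edom_nm(2)[OF that] gv by metis
  have "x \<in> halting_set \<longleftrightarrow> \<not> (h gvec = hvec \<or> h gvec = - hvec)"
  proof (cases "x \<in> halting_set")
    case True
    then have "ambient x = big" by (simp add: ambient_def)
    with iso_big[of h] add him True show ?thesis by simp
  next
    case False
    then have "ambient x = small" by (simp add: ambient_def)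
    with iso_small[of h] add him False show ?thesis by simp
  qed
  then show "x \<in> halting_set \<longleftrightarrow> \<not> (the (phi k (nm gvec)) = nm hvec \<or> the (phi k (nm gvec)) = nm (- hvec))"
    using val_iff hvec_in by (simp add: f_def)
qed

theorem theorem3p2:
  fixes F :: "nat list \<Rightarrow> nat"
  assumes "\<forall>(e::nat) (a::nat) (b::nat) (g::nat) (h::nat) (r::nat) (as::nat list) (bs::nat list).
     computable_group e \<and>
     is_char_index a \<and> is_char_index b \<and> is_char_index g \<and> is_char_index h \<and>
     internal_dsum (grp e) (Cset a) (Cset g) \<and>
     internal_dsum (grp e) (Cset b) (Cset h) \<and>
     (grp e)\<lparr>carrier := Cset a\<rparr> \<cong> (grp e)\<lparr>carrier := Cset b\<rparr> \<and>
     has_rank ((grp e)\<lparr>carrier := Cset a\<rparr>) r \<and>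
     length as = length bs \<and>
     set as \<subseteq> Cset a \<and> generate (grp e) (set as) = Cset a \<and>
     set bs \<subseteq> Cset b \<and> generate (grp e) (set bs) = Cset b
     \<longrightarrow> phi_iso (F ([e, a, b, g, h, r] @ as @ bs))
                  ((grp e)\<lparr>carrier := Cset g\<rparr>) ((grp e)\<lparr>carrier := Cset h\<rparr>)"
  shows "halting_le_T F"
proof -
  define orc where "orc = (\<lambda>c. F (list_decode c))"
  define query where "query x = [egrp x, eset TA x, eset TB x, eset TG x, eset TH x, 1, nm avec, nm bvec]" for x
  define k where "k x = orc (list_encode (query x))" for x
  have "phi_iso (F ([egrp x, eset TA x, eset TB x, eset TG x, eset TH x, 1] @ [nm avec] @ [nm bvec]))
      ((grp (egrp x))\<lparr>carrier := Cset (eset TG x)\<rparr>) ((grp (egrp x))\<lparr>carrier := Cset (eset TH x)\<rparr>)" for x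
    using assms instance_valid[of x] by blast
  then have iso: "phi_iso (k x) ((grp (egrp x))\<lparr>carrier := Cset (eset TG x)\<rparr>)
      ((grp (egrp x))\<lparr>carrier := Cset (eset TH x)\<rparr>)" for x
    by (simp add: k_def query_def orc_def)
  \<comment> \<open>The group and subset indices come from \<open>smn\<close> and the other entries
    are constants, so the query is computable in \<open>x\<close>.\<close>
  have "rcomp {orc} (\<lambda>x. list_encode (query x))"
    unfolding query_def list_encode.simps egrp_def eset_def by (intro rc rcomp_smn)
  then have "rcomp {orc} k"
    unfolding k_def by (rule rcomp_oracle) simp
  \<comment> \<open>The oracle answers with a program index. The universal machine evaluates it at
    the name of \<open>gvec\<close>, where it is defined because it indexes an isomorphism.\<close>
  then have "rcomp {orc} (\<lambda>x. the (phi (k x) (nm gvec)))"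
    using halting_iff_value(1)[OF iso] by (rule rcomp_phi)
  then have "rdec {orc} (\<lambda>x. \<not> (the (phi (k x) (nm gvec)) = nm hvec \<or> the (phi (k x) (nm gvec)) = nm (- hvec)))"
    by (intro rdec_not rdec_or rdec_eq rcomp_const)
  then have "rdec {orc} (\<lambda>x. x \<in> halting_set)"
    unfolding halting_iff_value(2)[OF iso, symmetric] .
  then show ?thesis
    unfolding halting_le_T_def rdec_def rcomp_def orc_def by simp
qed

end
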